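(* Let $0<a<b<\infty$, let $p>1$, $q=\frac{p}{p-1}$, $\alpha\in\left(\frac1p,1\right]$ and $\gamma\in\mathbb{R}$. Let $u\in AC[a,b]$ satisfy $u\in L^p(a,b)$, $u(a)=0$ and $\partial^{\alpha}_{a+}u\in L^p(a,b)$, where $\partial^\alpha_{a+}$ is the left Caputo fractional derivative of order $\alpha$. Then $$\left\|\frac{u}{x^{\gamma+1}}\right\|_{L^p(a,b)}\leq \frac{a^{-|\gamma|-1}\,b^{|\gamma|}\,(b-a)^{\alpha}}{\left(\alpha q-q+1\right)^{\frac{1}{q}}\Gamma(\alpha)} \left\|\frac{\partial^{\alpha}_{a+}u}{x^{\gamma}}\right\|_{L^p(a,b)}.$$
   Context: $AC[a,b]$ is the space of (real- or complex-valued) absolutely continuous functions on $[a,b]$, $x$ denotes the variable in $(a,b)$, and $\Gamma$ is the Euler gamma function. For $\alpha>0$ the left Riemann--Liouville integral is $I_{a+}^\alpha f(t)=\frac{1}{\Gamma(\alpha)}\int_a^t (t-s)^{\alpha-1}f(s)\,ds$, $t\in(a,b]$, and $I_{a+}^0 f=f$. For $0<\alpha\le 1$ and $f\in AC[a,b]$ the left Caputo fractional derivative is $\partial_{a+}^\alpha f(t)=I_{a+}^{1-\alpha}f'(t)$ (defined for almost every $t$); in particular $\partial_{a+}^1 f=f'$. *)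

theory Defs
  imports "HOL-Analysis.Analysis"
begin

text \<open>The library's \<open>absolutely_continuous\<close> is a relation between measures; absolute continuity
  of functions on a compact interval is the usual \<open>\<epsilon>\<close>-\<open>\<delta>\<close> condition over finite families of
  non-overlapping subintervals \<open>[s i, t i]\<close>.\<close>

definition AC_on :: "real \<Rightarrow> real \<Rightarrow> (real \<Rightarrow> 'a::real_normed_vector) \<Rightarrow> bool" where
  "AC_on a b f \<longleftrightarrow>
     (\<forall>\<epsilon>>0. \<exists>\<delta>>0. \<forall>(n::nat) (s::nat \<Rightarrow> real) t.
        (\<forall>i<n. a \<le> s i \<and> s i \<le> t i \<and> t i \<le> b) \<longrightarrow>
        (\<forall>i<n. \<forall>j<n. i \<noteq> j \<longrightarrow> {s i<..<t i} \<inter> {s j<..<t j} = {}) \<longrightarrow>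
        (\<Sum>i<n. t i - s i) < \<delta> \<longrightarrow>
        (\<Sum>i<n. norm (f (t i) - f (s i))) < \<epsilon>)"

definition in_Lp :: "real \<Rightarrow> real \<Rightarrow> real \<Rightarrow> (real \<Rightarrow> 'a::real_normed_vector) \<Rightarrow> bool" where
  "in_Lp p a b f \<longleftrightarrow>
     set_borel_measurable lebesgue {a<..<b} f \<and>
     set_integrable lebesgue {a<..<b} (\<lambda>x. norm (f x) powr p)"

text \<open>Meaningful for \<open>f\<close> with \<open>in_Lp p a b f\<close>; the Bochner integral of a non-integrable
  function is \<open>0\<close>.\<close>

definition Lp_norm :: "real \<Rightarrow> real \<Rightarrow> real \<Rightarrow> (real \<Rightarrow> 'a::real_normed_vector) \<Rightarrow> real" where
  "Lp_norm p a b f = (LINT x:{a<..<b}|lebesgue. norm (f x) powr p) powr (1 / p)"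

text \<open>For \<open>\<alpha> \<ge> 0\<close> and \<open>a < t\<close>.\<close>

definition RL_integral ::
  "real \<Rightarrow> real \<Rightarrow> (real \<Rightarrow> 'a::{banach, second_countable_topology}) \<Rightarrow> real \<Rightarrow> 'a" where
  "RL_integral a \<alpha> f t =
     (if \<alpha> = 0 then f t
      else (1 / Gamma \<alpha>) *\<^sub>R (LINT s:{a<..<t}|lebesgue. ((t - s) powr (\<alpha> - 1)) *\<^sub>R f s))"

text \<open>For \<open>0 < \<alpha> \<le> 1\<close> and absolutely continuous \<open>f\<close>. Such an \<open>f\<close> is differentiable almost
  everywhere; at the remaining points \<open>vector_derivative\<close> has an unspecified value, which
  affects neither the integral nor membership in \<open>L\<^sup>p\<close> or the norm.\<close>

definition caputo ::
  "real \<Rightarrow> real \<Rightarrow> (real \<Rightarrow> 'a::{banach, second_countable_topology}) \<Rightarrow> real \<Rightarrow> 'a" where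
  "caputo a \<alpha> f = RL_integral a (1 - \<alpha>) (\<lambda>s. vector_derivative f (at s))"

end

theory Submission
  imports Defs
begin

text \<open>An absolutely continuous \<open>u\<close> is the indefinite integral of an integrable \<open>g\<close>
  (Radon--Nikodym, applied to the total variation of \<open>u\<close> and to its difference with \<open>u\<close>), and
  \<open>u' = g\<close> almost everywhere (Henstock's lemma and Vitali coverings). Fubini and the Beta integral
  then turn \<open>u(t) = \<integral> g\<close> into \<open>u = I\<^sup>\<alpha>(\<partial>\<^sup>\<alpha> u)\<close>, from which Hoelder's inequality gives a pointwise bound of \<open>u\<close>
  by the \<open>L\<^sup>p\<close> norm of its Caputo derivative. The weights are bounded by their extreme
  values on \<open>(a,b)\<close>.\<close>

section \<open>Families of non-overlapping intervals and total variation\<close>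

text \<open>The statement integrates over \<open>lebesgue\<close> and differentiates with
  \<open>vector_derivative\<close>, whose values on a null set are arbitrary, while Fubini and
  Radon--Nikodym are applied on \<open>lborel\<close>. A Borel density \<open>g\<close> therefore
  stands in for u' under every integral sign. Radon--Nikodym wants a positive measure, so
  \<open>u\<close> is split into coordinates and each coordinate into a difference of two increasing
  functions; the delicate point is that the variation inherits absolute continuity. Hoelder's
  inequality pairs the Caputo derivative in L^p with the kernel (t-s)^(\<alpha>-1) in L^q. The q-th
  power of the kernel is integrable because \<alpha> > 1/p means (\<alpha>-1)q > -1, and its
  integral is (t-a)^(\<alpha>q-q+1) / (\<alpha>q-q+1). Taking the q-th root leaves
  (b-a)^(\<alpha>-1/p) in the pointwise bound; the missing (b-a)^(1/p) is the L^p norm of the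
  constant 1. The largest value of x^\<gamma> times the largest value of x^(-\<gamma>) is
  (b/a)^|\<gamma>|, and the additional factor 1/x costs 1/a.\<close>

definition nonoverlapping :: "real \<Rightarrow> real \<Rightarrow> 'i set \<Rightarrow> ('i \<Rightarrow> real) \<Rightarrow> ('i \<Rightarrow> real) \<Rightarrow> bool" where
  "nonoverlapping a b I s t \<longleftrightarrow>
     (\<forall>i\<in>I. a \<le> s i \<and> s i \<le> t i \<and> t i \<le> b) \<and>
     (\<forall>i\<in>I. \<forall>j\<in>I. i \<noteq> j \<longrightarrow> {s i<..<t i} \<inter> {s j<..<t j} = {})"

definition AC_modulus :: "real \<Rightarrow> real \<Rightarrow> (real \<Rightarrow> 'a::real_normed_vector) \<Rightarrow> real \<Rightarrow> real \<Rightarrow> bool" where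
  "AC_modulus a b f \<epsilon> \<delta> \<longleftrightarrow>
     (\<forall>(n::nat) s t. nonoverlapping a b {..<n} s t \<longrightarrow> (\<Sum>i<n. t i - s i) < \<delta> \<longrightarrow>
        (\<Sum>i<n. norm (f (t i) - f (s i))) < \<epsilon>)"

lemma nonoverlapping_subset:
  assumes "nonoverlapping a b I s t"
    and "\<And>i. i \<in> I \<Longrightarrow> c \<le> s' i \<and> s' i \<le> t' i \<and> t' i \<le> d"
    and "\<And>i. i \<in> I \<Longrightarrow> {s' i<..<t' i} \<subseteq> {s i<..<t i}"
  shows "nonoverlapping c d I s' t'"
  using assms unfolding nonoverlapping_def by (metis (no_types, lifting) Int_mono subset_empty)

lemma AC_on_modulus: "AC_on a b f \<longleftrightarrow> (\<forall>\<epsilon>>0. \<exists>\<delta>>0. AC_modulus a b f \<epsilon> \<delta>)"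
  unfolding AC_on_def AC_modulus_def nonoverlapping_def Ball_def lessThan_iff imp_conjL ..

text \<open>Reindexing along a bijection with an initial segment frees the condition from
  natural-number indices. Later families are indexed by pairs and by the intervals
  themselves.\<close>

lemma AC_modulusD:
  assumes "AC_modulus a b f \<epsilon> \<delta>" "finite I" "nonoverlapping a b I s t" "(\<Sum>i\<in>I. t i - s i) < \<delta>"
  shows "(\<Sum>i\<in>I. norm (f (t i) - f (s i))) < \<epsilon>"
proof -
  obtain h where h: "bij_betw h {..<card I} I"
    using ex_bij_betw_nat_finite[OF assms(2)] by (auto simp: atLeast0LessThan)
  have "nonoverlapping a b {..<card I} (s \<circ> h) (t \<circ> h)"
    using assms(3) h bij_betwE[OF h] unfolding nonoverlapping_def
    by (auto simp: bij_betw_def inj_on_def) (metis lessThan_iff)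
  moreover have "(\<Sum>i<card I. (t \<circ> h) i - (s \<circ> h) i) = (\<Sum>i\<in>I. t i - s i)"
    using sum.reindex_bij_betw[OF h, of "\<lambda>i. t i - s i"] by simp
  moreover have "(\<Sum>i<card I. norm (f ((t \<circ> h) i) - f ((s \<circ> h) i))) = (\<Sum>i\<in>I. norm (f (t i) - f (s i)))"
    using sum.reindex_bij_betw[OF h, of "\<lambda>i. norm (f (t i) - f (s i))"] by simp
  ultimately show ?thesis
    using assms(1,4) unfolding AC_modulus_def by metis
qed

lemma nonoverlapping_length_le_measure:
  assumes no: "nonoverlapping x y I s t" and "finite I"
    and S: "S \<in> lmeasurable" "(\<Union>i\<in>I. {s i<..<t i}) \<subseteq> S"
  shows "(\<Sum>i\<in>I. t i - s i) \<le> measure lebesgue S"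
proof -
  have st: "s i \<le> t i" if "i \<in> I" for i
    using no that unfolding nonoverlapping_def by blast
  have "disjoint_family_on (\<lambda>i. {s i<..<t i}) I"
    using no unfolding nonoverlapping_def disjoint_family_on_def by blast
  then have "measure lebesgue (\<Union>i\<in>I. {s i<..<t i}) = (\<Sum>i\<in>I. measure lebesgue {s i<..<t i})"
    by (intro measure_finite_Union) (use st \<open>finite I\<close> in auto)
  also have "\<dots> = (\<Sum>i\<in>I. t i - s i)"
    by (intro sum.cong refl) (simp add: st)
  finally have "(\<Sum>i\<in>I. t i - s i) = measure lebesgue (\<Union>i\<in>I. {s i<..<t i})" by simp
  also have "\<dots> \<le> measure lebesgue S"
    by (intro measure_mono_fmeasurable S sets.finite_UN) (use \<open>finite I\<close> in auto)
  finally show ?thesis .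
qed

lemma nonoverlapping_length_le:
  assumes no: "nonoverlapping x y {..<n::nat} s t" and "x \<le> y"
  shows "(\<Sum>i<n. t i - s i) \<le> y - x"
proof -
  have st: "x \<le> s i" "t i \<le> y" if "i < n" for i
    using no that unfolding nonoverlapping_def by blast+
  have "(\<Union>i\<in>{..<n}. {s i<..<t i}) \<subseteq> cbox x y"
  proof
    fix z assume "z \<in> (\<Union>i\<in>{..<n}. {s i<..<t i})"
    then obtain i where "i < n" "s i < z" "z < t i" by auto
    then show "z \<in> cbox x y" using st[of i] by auto
  qed
  from nonoverlapping_length_le_measure[OF no _ lmeasurable_cbox this]
  show ?thesis using assms(2) by simp
qed

lemma AC_onE:
  assumes "AC_on a b f" "\<epsilon> > 0"
  obtains \<delta> where "\<delta> > 0" "AC_modulus a b f \<epsilon> \<delta>"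
  using assms AC_on_modulus by metis

text \<open>Meant for coordinate functions, whose increments are dominated by those of
  \<open>f\<close>.\<close>

lemma AC_on_dominated:
  assumes "AC_on a b f" "\<And>x y. norm (g x - g y) \<le> norm (f x - f y)"
  shows "AC_on a b g"
  unfolding AC_on_modulus
proof (intro allI impI)
  fix \<epsilon> :: real assume "\<epsilon> > 0"
  then obtain \<delta> where d: "\<delta> > 0" "AC_modulus a b f \<epsilon> \<delta>" using AC_onE assms(1) by blast
  have "AC_modulus a b g \<epsilon> \<delta>"
    unfolding AC_modulus_def
  proof (intro allI impI)
    fix n and s t :: "nat \<Rightarrow> real"
    assume no: "nonoverlapping a b {..<n} s t" and l: "(\<Sum>i<n. t i - s i) < \<delta>"
    have "(\<Sum>i<n. norm (g (t i) - g (s i))) \<le> (\<Sum>i<n. norm (f (t i) - f (s i)))"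
      by (intro sum_mono assms(2))
    also have "\<dots> < \<epsilon>" using d(2) no l unfolding AC_modulus_def by blast
    finally show "(\<Sum>i<n. norm (g (t i) - g (s i))) < \<epsilon>" .
  qed
  with d show "\<exists>\<delta>>0. AC_modulus a b g \<epsilon> \<delta>" by blast
qed

lemma AC_on_diff:
  assumes "AC_on a b f" "AC_on a b g"
  shows "AC_on a b (\<lambda>x. f x - g x)"
  unfolding AC_on_modulus
proof (intro allI impI)
  fix \<epsilon> :: real assume "\<epsilon> > 0"
  then obtain d1 d2 where d: "d1 > 0" "AC_modulus a b f (\<epsilon>/2) d1" "d2 > 0" "AC_modulus a b g (\<epsilon>/2) d2"
    using AC_onE assms by (metis half_gt_zero)
  have "AC_modulus a b (\<lambda>x. f x - g x) \<epsilon> (min d1 d2)"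
    unfolding AC_modulus_def
  proof (intro allI impI)
    fix n and s t :: "nat \<Rightarrow> real"
    assume no: "nonoverlapping a b {..<n} s t" and l: "(\<Sum>i<n. t i - s i) < min d1 d2"
    have "(\<Sum>i<n. norm (f (t i) - g (t i) - (f (s i) - g (s i))))
        \<le> (\<Sum>i<n. norm (f (t i) - f (s i)) + norm (g (t i) - g (s i)))"
    proof (intro sum_mono)
      fix i
      have "f (t i) - g (t i) - (f (s i) - g (s i)) = (f (t i) - f (s i)) - (g (t i) - g (s i))" by simp
      then show "norm (f (t i) - g (t i) - (f (s i) - g (s i))) \<le> norm (f (t i) - f (s i)) + norm (g (t i) - g (s i))"
        by (metis norm_triangle_ineq4)
    qed
    also have "\<dots> < \<epsilon>"
    proof -
      have "(\<Sum>i<n. norm (f (t i) - f (s i))) < \<epsilon>/2" "(\<Sum>i<n. norm (g (t i) - g (s i))) < \<epsilon>/2"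
        using d(2,4) no l unfolding AC_modulus_def by auto
      then show ?thesis by (simp add: sum.distrib)
    qed
    finally show "(\<Sum>i<n. norm (f (t i) - g (t i) - (f (s i) - g (s i)))) < \<epsilon>" .
  qed
  with d show "\<exists>\<delta>>0. AC_modulus a b (\<lambda>x. f x - g x) \<epsilon> \<delta>" by (meson min_less_iff_conj)
qed

lemma AC_on_imp_continuous_on:
  assumes "AC_on a b f"
  shows "continuous_on {a..b} f"
  unfolding continuous_on_iff
proof (intro ballI allI impI)
  fix x and \<epsilon> :: real assume x: "x \<in> {a..b}" and "\<epsilon> > 0"
  then obtain \<delta> where d: "\<delta> > 0" "AC_modulus a b f \<epsilon> \<delta>" using AC_onE assms by blast
  show "\<exists>d>0. \<forall>y\<in>{a..b}. dist y x < d \<longrightarrow> dist (f y) (f x) < \<epsilon>"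
  proof (intro exI[of _ \<delta>] conjI ballI impI d)
    fix y assume y: "y \<in> {a..b}" "dist y x < \<delta>"
    \<comment> \<open>A family with a single interval, indexed by \<open>()\<close>;
      \<open>min\<close> and \<open>max\<close> treat both orders of \<open>x\<close> and
      \<open>y\<close>.\<close>
    have "(\<Sum>i\<in>{()}. norm (f (max x y) - f (min x y))) < \<epsilon>"
      by (rule AC_modulusD[OF d(2)]) (use x y in \<open>auto simp: nonoverlapping_def dist_real_def\<close>)
    then show "dist (f y) (f x) < \<epsilon>"
      by (auto simp: dist_norm max_def min_def norm_minus_commute split: if_splits)
  qed
qed

section \<open>Total variation\<close>

text \<open>Gaps between the intervals are allowed, unlike in a partition. Filling a gap can only
  enlarge a sum, so the supremum is the usual total variation, and the families are the very ones
  that absolute continuity speaks about.\<close>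

definition variation_sums :: "(real \<Rightarrow> 'a::real_normed_vector) \<Rightarrow> real \<Rightarrow> real \<Rightarrow> real set" where
  "variation_sums f x y =
     {(\<Sum>i<n. norm (f (t i) - f (s i))) | (n::nat) s t. nonoverlapping x y {..<n} s t}"

text \<open>Taken in \<open>ennreal\<close>, so that the supremum is meaningful before finiteness is
  known.\<close>

definition variation :: "(real \<Rightarrow> 'a::real_normed_vector) \<Rightarrow> real \<Rightarrow> real \<Rightarrow> ennreal" where
  "variation f x y = (SUP v\<in>variation_sums f x y. ennreal v)"

lemma variation_upper:
  assumes "nonoverlapping x y {..<n::nat} s t"
  shows "ennreal (\<Sum>i<n. norm (f (t i) - f (s i))) \<le> variation f x y"
  unfolding variation_def variation_sums_def by (rule SUP_upper) (use assms in blast)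

lemma variation_mono: "x' \<le> x \<Longrightarrow> y \<le> y' \<Longrightarrow> variation f x y \<le> variation f x' y'"
  unfolding variation_def
proof (intro SUP_subset_mono order_refl)
  assume "x' \<le> x" "y \<le> y'"
  then have "nonoverlapping x y {..<n} s t \<Longrightarrow> nonoverlapping x' y' {..<n} s t" for n :: nat and s t
    unfolding nonoverlapping_def by force
  then show "variation_sums f x y \<subseteq> variation_sums f x' y'"
    unfolding variation_sums_def by blast
qed

text \<open>Clamping endpoints with \<open>min\<close> and \<open>max\<close> may create degenerate intervals, which is why these
  families are indexed and allow \<open>s i = t i\<close>.\<close>

lemma variation_sums_cut:
  assumes "nonoverlapping x z {..<n::nat} s t" "x \<le> y" "y \<le> z"
  shows "ennreal (\<Sum>i<n. norm (f (t i) - f (s i))) \<le> variation f x y + variation f y z"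
proof -
  let ?A = "\<Sum>i<n. norm (f (min (t i) y) - f (min (s i) y))"
  let ?B = "\<Sum>i<n. norm (f (max (t i) y) - f (max (s i) y))"
  have no: "x \<le> s i \<and> s i \<le> t i \<and> t i \<le> z" if "i < n" for i
    using assms(1) that unfolding nonoverlapping_def by blast
  have 1: "nonoverlapping x y {..<n} (\<lambda>i. min (s i) y) (\<lambda>i. min (t i) y)"
  proof (rule nonoverlapping_subset[OF assms(1)])
    fix i assume "i \<in> {..<n}"
    then show "x \<le> min (s i) y \<and> min (s i) y \<le> min (t i) y \<and> min (t i) y \<le> y"
      using no[of i] assms(2) by (simp add: min_le_iff_disj)
  qed auto
  have 2: "nonoverlapping y z {..<n} (\<lambda>i. max (s i) y) (\<lambda>i. max (t i) y)"
  proof (rule nonoverlapping_subset[OF assms(1)])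
    fix i assume "i \<in> {..<n}"
    then show "y \<le> max (s i) y \<and> max (s i) y \<le> max (t i) y \<and> max (t i) y \<le> z"
      using no[of i] assms(3) by auto
  qed auto
  have "norm (f (t i) - f (s i)) \<le> norm (f (min (t i) y) - f (min (s i) y)) + norm (f (max (t i) y) - f (max (s i) y))" for i
  proof -
    \<comment> \<open>For every z, f (min z y) + f (max z y) = f z + f y; the identity is the
      difference of the instances \<open>t i\<close> and \<open>s i\<close>.\<close>
    have "f (t i) - f (s i) = (f (min (t i) y) - f (min (s i) y)) + (f (max (t i) y) - f (max (s i) y))"
      by (simp add: min_def max_def)
    then show ?thesis by (simp only: norm_triangle_ineq)
  qed
  then have "(\<Sum>i<n. norm (f (t i) - f (s i))) \<le> ?A + ?B"
    unfolding sum.distrib[symmetric] by (intro sum_mono)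
  then have "ennreal (\<Sum>i<n. norm (f (t i) - f (s i))) \<le> ennreal ?A + ennreal ?B"
    by (subst ennreal_plus[symmetric]) (auto intro!: sum_nonneg ennreal_leI)
  also have "\<dots> \<le> variation f x y + variation f y z"
    by (intro add_mono variation_upper 1 2)
  finally show ?thesis .
qed

lemma variation_subadditive:
  assumes "x \<le> y" "y \<le> z"
  shows "variation f x z \<le> variation f x y + variation f y z"
  unfolding variation_def[of f x z]
  by (rule SUP_least) (use assms variation_sums_cut in \<open>auto simp: variation_sums_def\<close>)

text \<open>Every family on \<open>{x..y}\<close> can be extended by the interval from
  \<open>y\<close> to \<open>z\<close>. A single increment beyond \<open>y\<close> is enough to make
  both the variation and its difference with \<open>f\<close> increasing.\<close>

lemma variation_add_increment:
  assumes "x \<le> y" "y \<le> z"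
  shows "variation f x y + ennreal (norm (f z - f y)) \<le> variation f x z"
proof -
  have "{} \<noteq> variation_sums f x y"
    unfolding variation_sums_def nonoverlapping_def by (auto intro!: exI[of _ "0::nat"])
  then have "variation f x y + ennreal (norm (f z - f y))
      = (SUP v\<in>variation_sums f x y. ennreal v + ennreal (norm (f z - f y)))"
    unfolding variation_def by (simp add: ennreal_SUP_add_left)
  also have "\<dots> \<le> variation f x z"
  proof (rule SUP_least)
    fix v assume "v \<in> variation_sums f x y"
    then obtain n :: nat and s t where v: "v = (\<Sum>i<n. norm (f (t i) - f (s i)))" and
      no: "nonoverlapping x y {..<n} s t"
      unfolding variation_sums_def by blast
    define s' t' where "s' = s(n := y)" "t' = t(n := z)"
    have n': "nonoverlapping x z {..<Suc n} s' t'"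
      unfolding nonoverlapping_def
    proof (intro conjI ballI impI)
      fix i j assume ij: "i \<in> {..<Suc n}" "j \<in> {..<Suc n}" "i \<noteq> j"
      then consider "i < n" "j < n" | "i < n" "j = n" | "j < n" "i = n" by fastforce
      then show "{s' i<..<t' i} \<inter> {s' j<..<t' j} = {}"
        by cases (use no ij in \<open>auto simp: s'_t'_def nonoverlapping_def min_le_iff_disj le_max_iff_disj\<close>)
    qed (use no assms in \<open>force simp: s'_t'_def nonoverlapping_def less_Suc_eq\<close>)+
    have "(\<Sum>i<Suc n. norm (f (t' i) - f (s' i))) = v + norm (f z - f y)"
      by (simp add: v s'_t'_def)
    moreover have "v \<ge> 0" unfolding v by (simp add: sum_nonneg)
    ultimately show "ennreal v + ennreal (norm (f z - f y)) \<le> variation f x z"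
      using variation_upper[OF n', of f] by (simp flip: ennreal_plus)
  qed
  finally show ?thesis .
qed

lemma AC_modulus_variation_le:
  assumes "AC_modulus a b f \<epsilon> \<delta>" "a \<le> x" "y \<le> b" "y - x < \<delta>" "\<delta> > 0"
  shows "variation f x y \<le> ennreal \<epsilon>"
  unfolding variation_def
proof (rule SUP_least)
  fix v assume "v \<in> variation_sums f x y"
  then obtain n :: nat and s t where v: "v = (\<Sum>i<n. norm (f (t i) - f (s i)))" and
      no: "nonoverlapping x y {..<n} s t"
    unfolding variation_sums_def by blast
  have "(\<Sum>i<n. t i - s i) < \<delta>"
  proof (cases "x \<le> y")
    case True
    then show ?thesis using nonoverlapping_length_le[OF no] assms by simp
  next
    case False
    \<comment> \<open>On a reversed interval only the empty family exists.\<close>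
    have "n = 0"
    proof (rule ccontr)
      assume "n \<noteq> 0"
      with no have "x \<le> s 0 \<and> s 0 \<le> t 0 \<and> t 0 \<le> y" unfolding nonoverlapping_def by blast
      with False show False by linarith
    qed
    then show ?thesis using assms by simp
  qed
  moreover have "nonoverlapping a b {..<n} s t"
    using no assms unfolding nonoverlapping_def by force
  ultimately show "ennreal v \<le> ennreal \<epsilon>"
    using assms(1) unfolding AC_modulus_def v by (meson ennreal_leI less_imp_le)
qed

text \<open>With the \<delta> belonging to \<epsilon> = 1, each step of length \<delta>/2 adds at
  most 1 to the variation, and finitely many steps lead from \<open>a\<close> to
  \<open>b\<close>.\<close>

lemma AC_on_variation_finite:
  assumes "AC_on a b f" "a \<le> b"
  shows "variation f a b < \<infinity>"
proof -
  obtain \<delta> where d: "\<delta> > 0" "AC_modulus a b f 1 \<delta>" using AC_onE[OF assms(1), of 1] by auto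
  have "variation f a (min b (a + real n * (\<delta>/2))) < \<infinity>" for n
  proof (induction n)
    case 0
    have "variation f a a \<le> ennreal 1"
      using AC_modulus_variation_le[OF d(2), of a a] assms d by auto
    then show ?case using assms by (simp add: order_le_less_trans)
  next
    case (Suc n)
    let ?y = "\<lambda>n. min b (a + real n * (\<delta>/2))"
    have "variation f (?y n) (?y (Suc n)) \<le> ennreal 1"
      using assms d by (intro AC_modulus_variation_le[OF d(2)]) (auto simp: min_def field_simps)
    moreover have "variation f a (?y (Suc n)) \<le> variation f a (?y n) + variation f (?y n) (?y (Suc n))"
      using assms d by (intro variation_subadditive) (auto simp: min_def field_simps)
    ultimately show ?case
      using Suc by (smt (verit) ennreal_less_top infinity_ennreal_def order_le_less_trans add_left_mono ennreal_add_less_top)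
  qed
  note fin = this
  obtain n :: nat where "b - a < real n * (\<delta>/2)"
    using reals_Archimedean3[of "\<delta>/2"] d(1) half_gt_zero by blast
  then have "min b (a + real n * (\<delta>/2)) = b" by auto
  then show ?thesis using fin[of n] by simp
qed

text \<open>The families behind the \<open>v i\<close> sit inside non-overlapping intervals, so
  together they form one non-overlapping family, indexed by pairs, of total length below \<delta>. A
  single application of the modulus then bounds all \<open>n\<close> sums at once, without a factor
  \<open>n\<close>.\<close>

lemma AC_modulus_sum_variation_le:
  assumes AC: "AC_modulus a b f \<epsilon> \<delta>" and no: "nonoverlapping a b {..<n::nat} s t"
    and len: "(\<Sum>i<n. t i - s i) < \<delta>"
    and v: "\<And>i. i < n \<Longrightarrow> v i \<in> variation_sums f (s i) (t i)"
  shows "(\<Sum>i<n. v i) < \<epsilon>"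
proof -
  have "\<forall>i. \<exists>m S T. i < n \<longrightarrow> v i = (\<Sum>k<m::nat. norm (f (T k) - f (S k))) \<and> nonoverlapping (s i) (t i) {..<m} S T"
    using v unfolding variation_sums_def by blast
  then obtain m S T where vi: "\<And>i. i < n \<Longrightarrow> v i = (\<Sum>k<m i::nat. norm (f (T i k) - f (S i k)))"
    and ni: "\<And>i. i < n \<Longrightarrow> nonoverlapping (s i) (t i) {..<m i} (S i) (T i)"
    unfolding choice_iff by blast
  let ?I = "Sigma {..<n} (\<lambda>i. {..<m i})"
  have no': "nonoverlapping a b ?I (\<lambda>(i,k). S i k) (\<lambda>(i,k). T i k)"
    unfolding nonoverlapping_def
  proof (intro conjI ballI impI)
    fix p assume "p \<in> ?I"
    then obtain i k where p: "p = (i,k)" "i < n" "k < m i" by auto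
    have "a \<le> s i" "t i \<le> b" "s i \<le> S i k" "S i k \<le> T i k" "T i k \<le> t i"
      using no ni[OF p(2)] p unfolding nonoverlapping_def by auto
    then show "a \<le> (case p of (i,k) \<Rightarrow> S i k)" "(case p of (i,k) \<Rightarrow> S i k) \<le> (case p of (i,k) \<Rightarrow> T i k)"
      "(case p of (i,k) \<Rightarrow> T i k) \<le> b"
      by (auto simp: p)
  next
    fix p r assume "p \<in> ?I" "r \<in> ?I" "p \<noteq> r"
    then obtain i k j l where p: "p = (i,k)" "r = (j,l)" "i < n" "j < n" "k < m i" "l < m j" by auto
    show "{case p of (i,k) \<Rightarrow> S i k<..<case p of (i,k) \<Rightarrow> T i k} \<inter> {case r of (i,k) \<Rightarrow> S i k<..<case r of (i,k) \<Rightarrow> T i k} = {}"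
    proof (cases "i = j")
      case True
      then have "k \<noteq> l" using p \<open>p \<noteq> r\<close> by auto
      then show ?thesis using ni[OF p(3)] p(5,6) True unfolding nonoverlapping_def p prod.case by blast
    next
      case False
      have "{S i k<..<T i k} \<subseteq> {s i<..<t i}" "{S j l<..<T j l} \<subseteq> {s j<..<t j}"
        using ni[OF p(3)] ni[OF p(4)] p(5,6) unfolding nonoverlapping_def
        by (metis greaterThanLessThan_subseteq_greaterThanLessThan lessThan_iff)+
      moreover have "{s i<..<t i} \<inter> {s j<..<t j} = {}"
        using no False p(3,4) unfolding nonoverlapping_def by blast
      ultimately show ?thesis unfolding p prod.case by blast
    qed
  qed
  have le: "(\<Sum>k<m i. T i k - S i k) \<le> t i - s i" if i: "i < n" for i
  proof -
    have n1: "nonoverlapping (s i) (t i) {..<m i} (S i) (T i)" and st: "s i \<le> t i"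
      using ni i no unfolding nonoverlapping_def by auto
    then show ?thesis by (rule nonoverlapping_length_le)
  qed
  have "(\<Sum>p\<in>?I. (case p of (i,k) \<Rightarrow> T i k) - (case p of (i,k) \<Rightarrow> S i k)) = (\<Sum>i<n. \<Sum>k<m i. T i k - S i k)"
    by (subst sum.Sigma) (auto intro!: sum.cong)
  also have "\<dots> \<le> (\<Sum>i<n. t i - s i)" using le by (intro sum_mono) auto
  also note len
  finally have "(\<Sum>p\<in>?I. norm (f (case p of (i,k) \<Rightarrow> T i k) - f (case p of (i,k) \<Rightarrow> S i k))) < \<epsilon>"
    by (intro AC_modulusD[OF AC _ no']) auto
  also have "(\<Sum>p\<in>?I. norm (f (case p of (i,k) \<Rightarrow> T i k) - f (case p of (i,k) \<Rightarrow> S i k))) = (\<Sum>i<n. v i)"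
    by (simp add: vi, subst sum.Sigma) (auto intro!: sum.cong)
  finally show ?thesis .
qed

section \<open>Absolutely continuous functions are indefinite integrals\<close>

text \<open>Near-optimal families on the individual intervals are merged into one family for
  \<open>f\<close>, which transfers the modulus of \<open>f\<close> at \<epsilon>/2 to the variation
  at \<epsilon>.\<close>

lemma AC_on_variation:
  assumes AC: "AC_on a b f" and ab: "a \<le> b"
  defines "v \<equiv> \<lambda>x. enn2real (variation f a x)"
  shows "AC_on a b v"
    and "\<And>x y. a \<le> x \<Longrightarrow> x \<le> y \<Longrightarrow> y \<le> b \<Longrightarrow> norm (f y - f x) \<le> v y - v x"
proof -
  have fin: "variation f x y < \<infinity>" if "a \<le> x" "y \<le> b" for x y
    using variation_mono[of a x y b f] AC_on_variation_finite[OF AC ab] that by (auto intro: le_less_trans)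
  then have real: "variation f x y = ennreal (enn2real (variation f x y))" if "a \<le> x" "y \<le> b" for x y
    using that by (simp add: less_top)
  show inc: "norm (f y - f x) \<le> v y - v x" if xy: "a \<le> x" "x \<le> y" "y \<le> b" for x y
  proof -
    have "ennreal (v x) + ennreal (norm (f y - f x)) \<le> ennreal (v y)"
      using variation_add_increment[of a x y f] real[of a x] real[of a y] xy unfolding v_def by simp
    then have "v x + norm (f y - f x) \<le> v y"
      by (simp add: v_def flip: ennreal_plus)
    then show ?thesis by simp
  qed
  have le: "v y - v x \<le> enn2real (variation f x y)" if xy: "a \<le> x" "x \<le> y" "y \<le> b" for x y
  proof -
    have "ennreal (v y) \<le> ennreal (v x) + ennreal (enn2real (variation f x y))"
      using variation_subadditive[of a x y f] real[of a x] real[of a y] real[of x y] xy unfolding v_def by simp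
    then have "v y \<le> v x + enn2real (variation f x y)"
      by (simp add: v_def flip: ennreal_plus)
    then show ?thesis by simp
  qed
  have approx: "\<exists>w\<in>variation_sums f x y. enn2real (variation f x y) \<le> w + \<eta>"
    if "a \<le> x" "y \<le> b" "\<eta> > 0" for x y \<eta>
  \<comment> \<open>\<open>ennreal\<close> truncates negative numbers to 0, so the supremum is
    approximated from below only when variation minus \<eta> is positive; otherwise the empty family
    does.\<close>
  proof (cases "enn2real (variation f x y) \<le> \<eta>")
    case True
    have "0 \<in> variation_sums f x y"
      unfolding variation_sums_def nonoverlapping_def by (auto intro!: exI[of _ "0::nat"])
    then show ?thesis using True by force
  next
    case False
    then have "ennreal (enn2real (variation f x y) - \<eta>) < variation f x y"
      using that by (subst real[OF that(1,2)]) (auto intro!: ennreal_lessI)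
    then obtain w where "w \<in> variation_sums f x y" "ennreal (enn2real (variation f x y) - \<eta>) < ennreal w"
      unfolding variation_def less_SUP_iff by blast
    then show ?thesis using False by (intro bexI[of _ w]) (auto simp: ennreal_less_iff)
  qed
  show "AC_on a b v"
    unfolding AC_on_modulus
  proof (intro allI impI)
    fix \<epsilon> :: real assume e: "\<epsilon> > 0"
    then obtain \<delta> where d: "\<delta> > 0" "AC_modulus a b f (\<epsilon>/2) \<delta>" using AC_onE[OF AC, of "\<epsilon>/2"] by auto
    have "AC_modulus a b v \<epsilon> \<delta>"
      unfolding AC_modulus_def
    proof (intro allI impI)
      fix n and s t :: "nat \<Rightarrow> real"
      assume no: "nonoverlapping a b {..<n} s t" and l: "(\<Sum>i<n. t i - s i) < \<delta>"
      have st: "a \<le> s i" "s i \<le> t i" "t i \<le> b" if "i < n" for i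
        using no that unfolding nonoverlapping_def by blast+
      \<comment> \<open>The \<open>n\<close> approximation errors together cost at most
        \<epsilon>/2; \<open>n + 1\<close> avoids division by zero for the empty family.\<close>
      define \<eta> where "\<eta> = \<epsilon> / (2 * (real n + 1))"
      have eta: "\<eta> > 0" "real n * \<eta> \<le> \<epsilon> / 2" using e by (auto simp: \<eta>_def field_simps)
      have "\<forall>i. \<exists>w. i < n \<longrightarrow> w \<in> variation_sums f (s i) (t i) \<and> enn2real (variation f (s i) (t i)) \<le> w + \<eta>"
        using approx[OF st(1) st(3) eta(1)] by metis
      then obtain w where w: "\<And>i. i < n \<Longrightarrow> w i \<in> variation_sums f (s i) (t i)"
        "\<And>i. i < n \<Longrightarrow> enn2real (variation f (s i) (t i)) \<le> w i + \<eta>"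
        unfolding choice_iff by blast
      have "(\<Sum>i<n. norm (v (t i) - v (s i))) \<le> (\<Sum>i<n. w i + \<eta>)"
      proof (intro sum_mono)
        fix i assume "i \<in> {..<n}"
        then have i: "i < n" by simp
        have "0 \<le> v (t i) - v (s i)" by (rule order_trans[OF norm_ge_zero inc[OF st[OF i]]])
        then show "norm (v (t i) - v (s i)) \<le> w i + \<eta>"
          using le[OF st[OF i]] w(2)[OF i] by simp
      qed
      also have "\<dots> = (\<Sum>i<n. w i) + real n * \<eta>" by (simp add: sum.distrib)
      also have "\<dots> < \<epsilon>"
        using AC_modulus_sum_variation_le[OF d(2) no l w(1)] eta(2) by simp
      finally show "(\<Sum>i<n. norm (v (t i) - v (s i))) < \<epsilon>" .
    qed
    with d show "\<exists>\<delta>>0. AC_modulus a b v \<epsilon> \<delta>" by blast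
  qed
qed

section \<open>Stieltjes measures and densities\<close>

text \<open>A null set is covered by non-overlapping intervals of total length below \<delta>. The
  Stieltjes measure of an interval is the increment of \<open>F\<close>, so absolute continuity
  bounds the measure of the cover by \<epsilon>. \<open>G\<close> extends \<open>F\<close> because
  \<open>interval_measure\<close> wants a function on the whole line.\<close>

lemma AC_on_null_interval_measure:
  fixes F :: "real \<Rightarrow> real"
  assumes AC: "AC_on a b F" and G_mono: "mono G" and G_cont: "continuous_on UNIV G"
    and FG: "\<And>x. x \<in> {a..b} \<Longrightarrow> G x = F x" and A: "A \<in> null_sets lborel"
  shows "emeasure (interval_measure G) ({a<..b} \<inter> A) = 0"
proof -
  let ?M = "interval_measure G"
  have "emeasure ?M ({a<..b} \<inter> A) \<le> 0 + ennreal \<epsilon>" if e: "\<epsilon> > 0" for \<epsilon> :: real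
  proof -
    obtain \<delta> where d: "\<delta> > 0" "AC_modulus a b F \<epsilon> \<delta>" using AC_onE[OF AC e] .
    let ?S = "{a<..b} \<inter> A"
    have null: "?S \<in> null_sets lebesgue"
      using A by (intro null_sets_completionI null_set_Int1) auto
    have S: "?S \<in> lmeasurable" "measure lebesgue ?S = 0"
      using null by (auto simp: fmeasurable_def null_sets_def measure_def)
    have sub: "?S \<subseteq> cbox a b" by auto
    obtain \<D> where D: "countable \<D>" "\<And>K. K \<in> \<D> \<Longrightarrow> K \<subseteq> cbox a b \<and> K \<noteq> {} \<and> (\<exists>c d. K = cbox c d)"
        "pairwise (\<lambda>A B. interior A \<inter> interior B = {}) \<D>"
        "?S \<subseteq> \<Union>\<D>" "\<Union>\<D> \<in> lmeasurable" "measure lebesgue (\<Union>\<D>) \<le> measure lebesgue ?S + \<delta>/2"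
      using measurable_outer_intervals_bounded[OF S(1) sub, of "\<delta>/2"] d(1) by (smt (verit) half_gt_zero)
    have K: "a \<le> Inf K" "Inf K \<le> Sup K" "Sup K \<le> b" "K = {Inf K..Sup K}" if "K \<in> \<D>" for K
    proof -
      obtain c d where cd: "K = {c..d}" using D(2)[OF \<open>K \<in> \<D>\<close>] by auto
      with D(2)[OF \<open>K \<in> \<D>\<close>] have "c \<le> d" "a \<le> c" "d \<le> b" by auto
      with cd show "a \<le> Inf K" "Inf K \<le> Sup K" "Sup K \<le> b" "K = {Inf K..Sup K}" by auto
    qed
    have fin: "emeasure ?M (\<Union>T) \<le> ennreal \<epsilon>" if T: "T \<subseteq> \<D>" "finite T" for T
    proof -
      \<comment> \<open>The intervals index themselves, with \<open>Inf\<close> and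
        \<open>Sup\<close> as endpoint functions.\<close>
      have no: "nonoverlapping a b T Inf Sup"
        unfolding nonoverlapping_def
      proof (intro conjI ballI impI)
        fix I J assume IJ: "I \<in> T" "J \<in> T" "I \<noteq> J"
        then have "interior I \<inter> interior J = {}"
          using D(3) T(1) unfolding pairwise_def by blast
        moreover have "interior I = {Inf I<..<Sup I}" "interior J = {Inf J<..<Sup J}"
          using K(4) IJ T(1) by (metis interior_atLeastAtMost_real subsetD)+
        ultimately show "{Inf I<..<Sup I} \<inter> {Inf J<..<Sup J} = {}" by simp
      qed (use K T(1) in blast)+
      have "(\<Union>i\<in>T. {Inf i<..<Sup i}) \<subseteq> \<Union>\<D>"
      proof
        fix x assume "x \<in> (\<Union>i\<in>T. {Inf i<..<Sup i})"
        then obtain i where i: "i \<in> T" "x \<in> {Inf i..Sup i}" by auto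
        then show "x \<in> \<Union>\<D>" using K(4)[of i] T(1) by (metis Union_iff subsetD)
      qed
      then have "(\<Sum>i\<in>T. Sup i - Inf i) < \<delta>"
        using nonoverlapping_length_le_measure[OF no T(2) D(5)] D(6) S(2) d(1) by simp
      then have less: "(\<Sum>i\<in>T. norm (F (Sup i) - F (Inf i))) < \<epsilon>"
        by (rule AC_modulusD[OF d(2) T(2) no])
      have K_sets: "i \<in> sets ?M" if "i \<in> T" for i
        using K(4)[of i] that T(1) by (metis atLeastAtMost_borel sets_interval_measure subsetD)
      have "emeasure ?M (\<Union>T) \<le> (\<Sum>i\<in>T. emeasure ?M i)"
        using emeasure_subadditive_finite[OF T(2), of "\<lambda>i. i" ?M] K_sets by auto
      also have "\<dots> = (\<Sum>i\<in>T. ennreal (norm (F (Sup i) - F (Inf i))))"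
      proof (intro sum.cong refl)
        fix i assume "i \<in> T"
        then have i: "i \<in> \<D>" using T by auto
        have "emeasure ?M i = emeasure ?M {Inf i..Sup i}" using K(4)[OF i] by simp
        also have "\<dots> = ennreal (G (Sup i) - G (Inf i))"
          by (intro emeasure_interval_measure_Icc K i monoD[OF G_mono] G_cont)
        also have "G (Sup i) - G (Inf i) = norm (F (Sup i) - F (Inf i))"
          using FG[of "Sup i"] FG[of "Inf i"] K(1-3)[OF i] monoD[OF G_mono K(2)[OF i]] by auto
        finally show "emeasure ?M i = ennreal (norm (F (Sup i) - F (Inf i)))" .
      qed
      also have "\<dots> = ennreal (\<Sum>i\<in>T. norm (F (Sup i) - F (Inf i)))" by simp
      also have "\<dots> \<le> ennreal \<epsilon>" using less by (intro ennreal_leI) simp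
      finally show ?thesis .
    qed
    have Dsets: "i \<in> sets ?M" if "i \<in> \<D>" for i
      using K(4)[of i] that by (metis atLeastAtMost_borel sets_interval_measure)
    have "emeasure ?M (\<Union>\<D>) \<le> ennreal \<epsilon>"
    proof (cases "\<D> = {}")
      case False
      \<comment> \<open>The modulus controls finite families only; increasing finite unions carry
        the bound to the countable cover.\<close>
      let ?U = "\<lambda>n::nat. \<Union>(from_nat_into \<D> ` {..n})"
      have in_D: "from_nat_into \<D> n \<in> \<D>" for n by (rule from_nat_into[OF False])
      have "(\<Union>n. ?U n) = \<Union>(range (from_nat_into \<D>))" by auto
      then have "\<Union>\<D> = (\<Union>n. ?U n)" using range_from_nat_into[OF False D(1)] by simp
      also have "emeasure ?M \<dots> = (SUP n. emeasure ?M (?U n))"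
      proof (intro SUP_emeasure_incseq[symmetric])
        show "range ?U \<subseteq> sets ?M"
          using Dsets in_D by (auto intro!: sets.finite_UN)
        show "incseq ?U" by (intro incseq_SucI) (auto simp: atMost_Suc)
      qed
      also have "\<dots> \<le> ennreal \<epsilon>"
        by (intro SUP_least fin) (use in_D in auto)
      finally show ?thesis .
    qed simp
    note D_le = this
    have "emeasure ?M ?S \<le> emeasure ?M (\<Union>\<D>)"
      using D(4) by (rule emeasure_mono) (use D(1) Dsets in \<open>blast intro: sets.countable_Union\<close>)
    also note D_le
    finally show ?thesis by (simp only: add_0)
  qed
  note eps = this
  have "emeasure ?M ({a<..b} \<inter> A) \<le> 0" by (rule ennreal_le_epsilon) (rule eps)
  then show ?thesis by simp
qed

text \<open>Half-open intervals match the formula for \<open>interval_measure\<close>;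
  \<open>lborel\<close> makes \<open>g\<close> Borel measurable, as Fubini will require.
  Integrability over the whole line lets \<open>g\<close> be restricted to any Borel set.\<close>

definition has_density :: "real \<Rightarrow> real \<Rightarrow> (real \<Rightarrow> 'a::euclidean_space) \<Rightarrow> (real \<Rightarrow> 'a) \<Rightarrow> bool" where
  "has_density a b f g \<longleftrightarrow> integrable lborel g \<and>
     (\<forall>x\<in>{a..b}. (LINT s:{a<..x}|lborel. g s) = f x - f a)"

lemma AC_on_mono_density:
  fixes F :: "real \<Rightarrow> real"
  assumes AC: "AC_on a b F" and mono: "mono_on {a..b} F" and ab: "a \<le> b"
  shows "\<exists>g. has_density a b F g"
proof -
  \<comment> \<open>Clamping the argument continues \<open>F\<close> by constants, which preserves
    monotonicity and continuity.\<close>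
  define G where "G = (\<lambda>x. F (max a (min b x)))"
  have G_mono: "mono G"
    unfolding G_def by (intro monoI monotone_onD[OF mono]) (use ab in auto)
  have G_cont: "continuous_on UNIV G"
    unfolding G_def
    by (rule continuous_on_compose2[OF AC_on_imp_continuous_on[OF AC]]) (use ab in \<open>auto intro!: continuous_intros\<close>)
  have FG: "G x = F x" if "x \<in> {a..b}" for x using that by (auto simp: G_def max_def min_def)
  let ?N = "density (interval_measure G) (indicator {a<..b})"
  have N: "emeasure ?N A = emeasure (interval_measure G) ({a<..b} \<inter> A)" if "A \<in> sets borel" for A
    using that by (intro emeasure_restricted) auto
  have "absolutely_continuous lborel ?N"
    unfolding absolutely_continuous_def
    using AC_on_null_interval_measure[OF AC G_mono G_cont FG] N by (auto simp: null_sets_def)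
  then obtain f where f: "f \<in> borel_measurable lborel" "density lborel f = ?N"
    using sigma_finite_measure.Radon_Nikodym[OF sigma_finite_lborel, of ?N] by auto
  have int: "(\<integral>\<^sup>+s. f s * indicator {a<..x} s \<partial>lborel) = ennreal (F x - F a)" if x: "x \<in> {a..b}" for x
  proof -
    have "(\<integral>\<^sup>+s. f s * indicator {a<..x} s \<partial>lborel) = emeasure ?N {a<..x}"
      using f by (simp add: emeasure_density flip: f(2))
    also have "\<dots> = emeasure (interval_measure G) {a<..x}"
      using x by (subst N) (auto simp: Int_absorb1)
    also have "\<dots> = ennreal (F x - F a)"
      using x G_mono G_cont FG[of a] FG[of x] ab
      by (subst emeasure_interval_measure_Ioc) (auto simp: monoD continuous_on_eq_continuous_within intro: continuous_within_subset)
    finally show ?thesis .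
  qed
  \<comment> \<open>The Radon--Nikodym derivative may be infinite, but only on a null subset of
    \<open>{a<..b}\<close>, since its integral there is \<open>F b - F a\<close>.
    \<open>enn2real\<close> sets it to 0 at such points.\<close>
  define g where "g = (\<lambda>x. enn2real (f x) * indicator {a<..b} x)"
  have [measurable]: "f \<in> borel_measurable borel" using f by simp
  have g_meas [measurable]: "g \<in> borel_measurable borel" unfolding g_def by simp
  have "AE x in lborel. f x * indicator {a<..b} x \<noteq> \<infinity>"
    using int[of b] ab by (intro nn_integral_PInf_AE) auto
  then have AE_g: "AE x in lborel. ennreal (g x) = f x * indicator {a<..b} x"
    by eventually_elim (auto simp: g_def less_top split: split_indicator)
  have g_int: "(\<integral>\<^sup>+s. ennreal (indicator {a<..x} s * g s) \<partial>lborel) = ennreal (F x - F a)" if x: "x \<in> {a..b}" for x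
  proof -
    have "(\<integral>\<^sup>+s. ennreal (indicator {a<..x} s * g s) \<partial>lborel) = (\<integral>\<^sup>+s. f s * indicator {a<..x} s \<partial>lborel)"
      using AE_g by (intro nn_integral_cong_AE, eventually_elim) (use x in \<open>auto split: split_indicator_asm split_indicator\<close>)
    then show ?thesis using int[OF x] by simp
  qed
  have g_nonneg: "g x \<ge> 0" for x by (simp add: g_def)
  have "integrable lborel g"
  proof (rule integrableI_nonneg)
    have "(\<integral>\<^sup>+x. ennreal (g x) \<partial>lborel) = (\<integral>\<^sup>+s. ennreal (indicator {a<..b} s * g s) \<partial>lborel)"
      by (intro nn_integral_cong) (auto simp: g_def split: split_indicator)
    also have "\<dots> < \<infinity>" using g_int[of b] ab by simp
    finally show "(\<integral>\<^sup>+x. ennreal (g x) \<partial>lborel) < \<infinity>" .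
  qed (auto simp: g_nonneg)
  moreover have "(LINT s:{a<..x}|lborel. g s) = F x - F a" if x: "x \<in> {a..b}" for x
    unfolding set_lebesgue_integral_def
    using g_int[OF x] x ab monotone_onD[OF mono, of a x]
    by (subst integral_eq_nn_integral) (auto simp: g_nonneg)
  ultimately show ?thesis unfolding has_density_def by blast
qed

lemma has_density_diff:
  assumes "has_density a b f g" "has_density a b f' g'"
  shows "has_density a b (\<lambda>x. f x - f' x) (\<lambda>x. g x - g' x)"
proof -
  have "set_integrable lborel {a<..x} g" "set_integrable lborel {a<..x} g'" for x
    using assms unfolding has_density_def set_integrable_def by (auto intro: integrable_mult_indicator)
  then show ?thesis
    using assms unfolding has_density_def by (auto simp: set_integral_diff)
qed

text \<open>Jordan decomposition: \<open>v\<close> and \<open>v - f\<close> are both increasing and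
  absolutely continuous, and \<open>f\<close> is their difference.\<close>

lemma AC_on_density_real:
  fixes f :: "real \<Rightarrow> real"
  assumes AC: "AC_on a b f" and ab: "a \<le> b"
  shows "\<exists>g. has_density a b f g"
proof -
  define v where "v = (\<lambda>x. enn2real (variation f a x))"
  have v: "AC_on a b v" "\<And>x y. a \<le> x \<Longrightarrow> x \<le> y \<Longrightarrow> y \<le> b \<Longrightarrow> norm (f y - f x) \<le> v y - v x"
    using AC_on_variation[OF AC ab] unfolding v_def by blast+
  have "mono_on {a..b} v"
    by (intro monotone_onI) (metis v(2) atLeastAtMost_iff diff_ge_0_iff_ge norm_ge_zero order_trans)
  moreover have "mono_on {a..b} (\<lambda>x. v x - f x)"
    by (intro monotone_onI) (use v(2) in fastforce)
  ultimately obtain g g' where "has_density a b v g" "has_density a b (\<lambda>x. v x - f x) g'"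
    using AC_on_mono_density v(1) AC_on_diff[OF v(1) AC] ab by metis
  then have "has_density a b (\<lambda>x. v x - (v x - f x)) (\<lambda>x. g x - g' x)" by (rule has_density_diff)
  then show ?thesis by auto
qed

text \<open>Works coordinatewise in the finite basis, which covers real and complex values at
  once.\<close>

lemma AC_on_density:
  fixes f :: "real \<Rightarrow> 'a::euclidean_space"
  assumes AC: "AC_on a b f" and ab: "a \<le> b"
  shows "\<exists>g. has_density a b f g"
proof -
  have "AC_on a b (\<lambda>x. f x \<bullet> i)" if "i \<in> Basis" for i
    by (rule AC_on_dominated[OF AC]) (use that Basis_le_norm in \<open>force simp flip: inner_diff_left\<close>)
  then have "\<forall>i. \<exists>g. i \<in> Basis \<longrightarrow> has_density a b (\<lambda>x. f x \<bullet> i) g"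
    using AC_on_density_real[OF _ ab] by blast
  then obtain g where g: "\<And>i. i \<in> Basis \<Longrightarrow> has_density a b (\<lambda>x. f x \<bullet> i) (g i)"
    unfolding choice_iff by blast
  let ?g = "\<lambda>x. \<Sum>i\<in>Basis. g i x *\<^sub>R i"
  have int: "integrable lborel (g i)" if "i \<in> Basis" for i using g[OF that] unfolding has_density_def by blast
  have "integrable lborel ?g" using int by auto
  moreover have "(LINT s:{a<..x}|lborel. ?g s) = f x - f a" if x: "x \<in> {a..b}" for x
  proof -
    have "set_integrable lborel {a<..x} (\<lambda>s. g i s *\<^sub>R i)" if "i \<in> Basis" for i
      using int[OF that] unfolding set_integrable_def
      by (intro integrable_mult_indicator integrable_scaleR_left) auto
    then have "(LINT s:{a<..x}|lborel. ?g s) = (\<Sum>i\<in>Basis. (LINT s:{a<..x}|lborel. g i s *\<^sub>R i))"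
      unfolding set_lebesgue_integral_def set_integrable_def scaleR_sum_right
      by (intro Bochner_Integration.integral_sum) auto
    also have "\<dots> = (\<Sum>i\<in>Basis. ((f x - f a) \<bullet> i) *\<^sub>R i)"
    proof (intro sum.cong refl)
      fix i :: 'a assume i: "i \<in> Basis"
      have "(LINT s:{a<..x}|lborel. g i s *\<^sub>R i) = (LINT s:{a<..x}|lborel. g i s) *\<^sub>R i"
        unfolding set_lebesgue_integral_def using int[OF i]
        by (subst integral_scaleR_left[symmetric]) (auto simp flip: real_scaleR_def intro: integrable_mult_indicator)
      also have "\<dots> = ((f x - f a) \<bullet> i) *\<^sub>R i"
        using g[OF i] x unfolding has_density_def by (simp add: inner_diff_left)
      finally show "(LINT s:{a<..x}|lborel. g i s *\<^sub>R i) = ((f x - f a) \<bullet> i) *\<^sub>R i" .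
    qed
    finally show ?thesis by (simp add: euclidean_representation)
  qed
  ultimately show ?thesis unfolding has_density_def by blast
qed

section \<open>Lebesgue differentiation on the line\<close>

text \<open>Identifies the intervals of Henstock's lemma with the balls of the Vitali covering
  theorem.\<close>

lemma cball_midpoint_real:
  fixes x y :: real
  shows "cball ((x + y) / 2) (\<bar>y - x\<bar> / 2) = {min x y..max x y}"
  by (auto simp: dist_real_def min_def max_def abs_if field_simps split: if_splits)

text \<open>Translates Lebesgue integrals over half-open intervals into gauge integrals over closed
  ones, the form in which Henstock's lemma applies.\<close>

lemma has_density_integral:
  assumes g: "has_density a b f g" and cd: "a \<le> c" "c \<le> d" "d \<le> b"
  shows "g integrable_on {c..d}" "integral {c..d} g = f d - f c"
proof -
  have int: "integrable lborel g" using g unfolding has_density_def by blast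
  then have si: "set_integrable lborel S g" if "S \<in> sets borel" for S
    using that unfolding set_integrable_def by (intro integrable_mult_indicator) auto
  show gi: "g integrable_on {c..d}" for c d
    using set_borel_integral_eq_integral(1)[OF si] by simp
  have eq: "integral {a..x} g = f x - f a" if "x \<in> {a..b}" for x
  proof -
    have "integral {a..x} g = (LINT s:{a..x}|lborel. g s)"
      using set_borel_integral_eq_integral(2)[OF si] by simp
    also have "\<dots> = (LINT s:{a<..x}|lborel. g s)"
      unfolding set_lebesgue_integral_def
    proof (rule integral_cong_AE)
      show "AE s in lborel. indicator {a..x} s *\<^sub>R g s = indicator {a<..x} s *\<^sub>R g s"
        using AE_lborel_singleton[of a] by eventually_elim (auto split: split_indicator)
    qed (use borel_measurable_integrable[OF int] in auto)
    finally show ?thesis using g that unfolding has_density_def by simp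
  qed
  have "integral {a..c} g + integral {c..d} g = integral {a..d} g"
    by (rule Henstock_Kurzweil_Integration.integral_combine) (use cd gi in auto)
  then show "integral {c..d} g = f d - f c"
    using eq[of c] eq[of d] cd by (simp add: algebra_simps)
qed

text \<open>Every point of \<open>E\<close> lies in arbitrarily short intervals on which the increment of \<open>f\<close> misses its
  linear prediction by the factor \<open>\<eta>\<close>; Henstock's lemma bounds the sum of these errors over
  disjoint intervals, hence the total length of a Vitali cover.\<close>

lemma negligible_density_not_derivative:
  fixes f :: "real \<Rightarrow> 'a::euclidean_space"
  assumes g: "has_density a b f g" and ab: "a < b" and eta: "\<eta> > 0"
  defines "E \<equiv> {x \<in> {a<..<b}. \<forall>d>0. \<exists>y. \<bar>y - x\<bar> < d \<and> norm (f y - f x - (y - x) *\<^sub>R g x) > \<eta> * \<bar>y - x\<bar>}"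
  shows "negligible E"
  unfolding negligible_outer_le
proof (intro allI impI)
  fix e :: real assume e: "e > 0"
  have "g integrable_on cbox a b" using has_density_integral(1)[OF g, of a b] ab by simp
  \<comment> \<open>The accuracy is \<open>e * \<eta>\<close> because each chosen interval has error
    above \<eta> times its length; the lengths then add up to less than \<open>e\<close>.\<close>
  then obtain \<gamma> where gamma: "gauge \<gamma>"
    and hen: "\<And>p. \<lbrakk>p tagged_partial_division_of (cbox a b); \<gamma> fine p\<rbrakk> \<Longrightarrow>
             (\<Sum>(x,k)\<in>p. norm (measure lborel k *\<^sub>R g x - integral k g)) < e * \<eta>"
    using Henstock_lemma[of g a b "e * \<eta>"] mult_pos_pos[OF e eta] by blast
  \<comment> \<open>A pair \<open>(x,y)\<close> codes the interval between \<open>x\<close> and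
    \<open>y\<close>, in either order, tagged at its endpoint \<open>x\<close>. Membership in
    \<open>K\<close> makes it fine for the gauge and bad for the derivative.\<close>
  define I where "I = (\<lambda>(x::real,y). {min x y..max x y})"
  define K where "K = {(x,y). x \<in> E \<and> I (x,y) \<subseteq> \<gamma> x \<and> I (x,y) \<subseteq> {a<..<b} \<and>
                     norm (f y - f x - (y - x) *\<^sub>R g x) > \<eta> * \<bar>y - x\<bar>}"
  let ?c = "\<lambda>(x::real,y). (x + y) / 2" and ?r = "\<lambda>(x::real,y). \<bar>y - x\<bar> / 2"
  have I_cball: "I i = cball (?c i) (?r i)" for i
    by (cases i) (simp add: I_def cball_midpoint_real)
  have pos: "0 < ?r i" if "i \<in> K" for i
    using that by (auto simp: K_def)
  have fine_cover: "\<exists>i. i \<in> K \<and> x \<in> cball (?c i) (?r i) \<and> ?r i < d" if x: "x \<in> E" and d: "0 < d" for x d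
  proof -
    have "open (\<gamma> x \<inter> {a<..<b})" "x \<in> \<gamma> x \<inter> {a<..<b}"
      using gamma x unfolding gauge_def E_def by auto
    then obtain d' where d': "d' > 0" "ball x d' \<subseteq> \<gamma> x \<inter> {a<..<b}"
      using open_contains_ball by metis
    obtain y where y: "\<bar>y - x\<bar> < min d d'" "norm (f y - f x - (y - x) *\<^sub>R g x) > \<eta> * \<bar>y - x\<bar>"
    proof -
      have "min d d' > 0" using d d'(1) by simp
      then show thesis using x that unfolding E_def by blast
    qed
    have "I (x,y) \<subseteq> ball x d'"
      using y(1) by (auto simp: I_def dist_real_def)
    then have "(x,y) \<in> K" using d' x y unfolding K_def by auto
    moreover have "x \<in> cball (?c (x,y)) (?r (x,y))" unfolding I_cball[symmetric] by (simp add: I_def)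
    moreover have "?r (x,y) < d" using y(1) by auto
    ultimately show ?thesis by blast
  qed
  obtain C where C: "countable C" "C \<subseteq> K"
     and disj: "pairwise (\<lambda>i j. disjnt (cball (?c i) (?r i)) (cball (?c j) (?r j))) C"
     and neg: "negligible (E - (\<Union>i \<in> C. cball (?c i) (?r i)))"
    using Vitali_covering_theorem_cballs[of K ?r E ?c, OF pos fine_cover] by blast
  have bound: "measure lebesgue (\<Union>i\<in>T. I i) \<le> e" if T: "T \<subseteq> C" "finite T" for T
  proof -
    define p where "p = (\<lambda>i. (fst i, I i)) ` T"
    have ne: "I i \<noteq> {}" for i by (cases i) (simp add: I_def)
    have dj: "I i \<inter> I j = {}" if "i \<in> T" "j \<in> T" "i \<noteq> j" for i j
      using disj that T(1) unfolding I_cball pairwise_def disjnt_def by blast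
    have inj: "inj_on (\<lambda>i. (fst i, I i)) T"
      by (rule inj_onI) (metis dj ne inf.idem prod.inject)
    have TK: "i \<in> K" if "i \<in> T" for i using that T C by blast
    have "p tagged_partial_division_of cbox a b"
      unfolding tagged_partial_division_of_def
    proof (intro conjI allI impI)
      show "finite p" using T(2) by (simp add: p_def)
      fix x J assume "(x, J) \<in> p"
      then obtain y where xy: "(x,y) \<in> K" "J = I (x,y)" using TK unfolding p_def by fastforce
      show "x \<in> J" using xy(2) by (simp add: I_def)
      show "J \<subseteq> cbox a b" using xy by (fastforce simp: K_def)
      show "\<exists>a b. J = cbox a b" using xy(2) by (auto simp: I_def)
    next
      fix x1 K1 x2 K2 assume "(x1, K1) \<in> p \<and> (x2, K2) \<in> p \<and> (x1, K1) \<noteq> (x2, K2)"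
      then obtain i j where "i \<in> T" "j \<in> T" "i \<noteq> j" "K1 = I i" "K2 = I j" by (auto simp: p_def)
      then have "K1 \<inter> K2 = {}" using dj by blast
      then show "interior K1 \<inter> interior K2 = {}" using interior_subset by blast
    qed
    moreover have "\<gamma> fine p"
      using TK unfolding p_def K_def by (intro fineI) fastforce
    ultimately have "(\<Sum>(x,k)\<in>p. norm (measure lborel k *\<^sub>R g x - integral k g)) < e * \<eta>" by (rule hen)
    also have "(\<Sum>(x,k)\<in>p. norm (measure lborel k *\<^sub>R g x - integral k g))
        = (\<Sum>i\<in>T. norm (measure lborel (I i) *\<^sub>R g (fst i) - integral (I i) g))"
      unfolding p_def by (subst sum.reindex[OF inj]) simp
    finally have less: "(\<Sum>i\<in>T. norm (measure lborel (I i) *\<^sub>R g (fst i) - integral (I i) g)) < e * \<eta>" .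
    have "(\<Sum>i\<in>T. \<eta> * measure lebesgue (I i)) \<le> (\<Sum>i\<in>T. norm (measure lborel (I i) *\<^sub>R g (fst i) - integral (I i) g))"
    proof (intro sum_mono)
      fix i assume "i \<in> T"
      then obtain x y where i: "i = (x,y)" and xy: "(x,y) \<in> K" using TK by (cases i) auto
      have "{min x y..max x y} \<subseteq> {a<..<b}" using xy unfolding K_def I_def by blast
      then have sub: "min x y \<in> {a<..<b}" "max x y \<in> {a<..<b}"
        by (rule subsetD, simp)+
      have content: "measure lborel (I i) = \<bar>y - x\<bar>" "measure lebesgue (I i) = \<bar>y - x\<bar>"
        by (auto simp: i I_def min_def max_def)
      have "integral (I i) g = f (max x y) - f (min x y)"
        unfolding i I_def prod.case by (rule has_density_integral(2)[OF g]) (use sub in auto)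
      then have eq: "measure lborel (I i) *\<^sub>R g (fst i) - integral (I i) g
          = \<bar>y - x\<bar> *\<^sub>R g x - (f (max x y) - f (min x y))"
        unfolding content by (simp add: i)
      have "norm (measure lborel (I i) *\<^sub>R g (fst i) - integral (I i) g) = norm (f y - f x - (y - x) *\<^sub>R g x)"
      \<comment> \<open>For \<open>x \<le> y\<close> the two errors differ by a sign, for
        \<open>y < x\<close> they are equal.\<close>
      proof (cases "x \<le> y")
        case True
        then show ?thesis unfolding eq by (simp add: norm_minus_commute)
      next
        case False
        then have "\<bar>y - x\<bar> *\<^sub>R g x - (f (max x y) - f (min x y)) = f y - f x - (y - x) *\<^sub>R g x"
          by (simp add: scaleR_left_diff_distrib)
        then show ?thesis unfolding eq by simp
      qed
      moreover have "norm (f y - f x - (y - x) *\<^sub>R g x) > \<eta> * \<bar>y - x\<bar>" using xy by (simp add: K_def)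
      ultimately show "\<eta> * measure lebesgue (I i) \<le> norm (measure lborel (I i) *\<^sub>R g (fst i) - integral (I i) g)"
        using content by simp
    qed
    with less have "\<eta> * (\<Sum>i\<in>T. measure lebesgue (I i)) < \<eta> * e" by (simp add: sum_distrib_left mult.commute)
    then have "(\<Sum>i\<in>T. measure lebesgue (I i)) < e" using eta by simp
    moreover have "measure lebesgue (\<Union>i\<in>T. I i) \<le> (\<Sum>i\<in>T. measure lebesgue (I i))"
      using T(2) by (intro measure_UNION_le) (auto simp: I_def)
    ultimately show ?thesis by simp
  qed
  have Im: "I i \<in> lmeasurable" for i unfolding I_cball by simp
  have U: "(\<Union>i\<in>C. I i) \<in> lmeasurable" "measure lebesgue (\<Union>i\<in>C. I i) \<le> e"
    using fmeasurable_UN_bound[OF C(1) Im bound] measure_UN_bound[OF C(1) Im bound] by blast+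
  let ?N = "E - (\<Union>i\<in>C. I i)"
  have N: "?N \<in> lmeasurable" "measure lebesgue ?N = 0"
    using neg negligible_imp_measurable negligible_imp_measure0 unfolding I_cball by blast+
  show "\<exists>T. E \<subseteq> T \<and> T \<in> lmeasurable \<and> measure lebesgue T \<le> e"
  proof (intro exI conjI)
    show "E \<subseteq> (\<Union>i\<in>C. I i) \<union> ?N" by blast
    show "(\<Union>i\<in>C. I i) \<union> ?N \<in> lmeasurable" using U N by blast
    show "measure lebesgue ((\<Union>i\<in>C. I i) \<union> ?N) \<le> e"
      using measure_Un_le[of "\<Union>i\<in>C. I i" lebesgue ?N] U N by (auto simp: fmeasurableD)
  qed
qed

text \<open>The tolerances 1/(n+1) suffice, so the exceptional points form a countable union of
  negligible sets.\<close>

lemma has_density_AE_vector_derivative: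
  fixes f :: "real \<Rightarrow> 'a::euclidean_space"
  assumes g: "has_density a b f g" and ab: "a < b"
  shows "AE x in lborel. a < x \<longrightarrow> x < b \<longrightarrow> (f has_vector_derivative g x) (at x)"
proof -
  define E where "E = (\<lambda>\<eta>. {x \<in> {a<..<b}. \<forall>d>0. \<exists>y. \<bar>y - x\<bar> < d \<and> norm (f y - f x - (y - x) *\<^sub>R g x) > \<eta> * \<bar>y - x\<bar>})"
  have "negligible (E \<eta>)" if "\<eta> > 0" for \<eta>
    unfolding E_def by (rule negligible_density_not_derivative[OF g ab that])
  then have "negligible (\<Union>n::nat. E (1 / Suc n))"
    by (intro negligible_countable_Union) auto
  then have "AE x in lebesgue. x \<notin> (\<Union>n::nat. E (1 / Suc n))"
    unfolding negligible_iff_null_sets by (rule AE_not_in)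
  then have "AE x in lborel. x \<notin> (\<Union>n::nat. E (1 / Suc n))"
    by (simp only: AE_completion_iff)
  then show ?thesis
  proof eventually_elim
    case (elim x)
    show ?case
    proof (intro impI)
      assume x: "a < x" "x < b"
      show "(f has_vector_derivative g x) (at x)"
        unfolding has_vector_derivative_def has_derivative_at_alt
      proof (intro conjI allI impI)
        show "bounded_linear (\<lambda>h. h *\<^sub>R g x)" by (rule bounded_linear_scaleR_left)
        fix e :: real assume "e > 0"
        then obtain n where n: "1 / Suc n < e" using nat_approx_posE by blast
        have "x \<notin> E (1 / Suc n)" using elim by blast
        then obtain d where d: "d > 0" "\<And>y. \<bar>y - x\<bar> < d \<Longrightarrow> norm (f y - f x - (y - x) *\<^sub>R g x) \<le> 1 / Suc n * \<bar>y - x\<bar>"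
          using x unfolding E_def by (auto simp: not_less not_le) (metis not_le)
        show "\<exists>d>0. \<forall>y. norm (y - x) < d \<longrightarrow> norm (f y - f x - (y - x) *\<^sub>R g x) \<le> e * norm (y - x)"
        proof (intro exI[of _ d] conjI allI impI d(1))
          fix y assume "norm (y - x) < d"
          then have "norm (f y - f x - (y - x) *\<^sub>R g x) \<le> 1 / Suc n * \<bar>y - x\<bar>" using d(2) by simp
          also have "\<dots> \<le> e * \<bar>y - x\<bar>" using n by (intro mult_right_mono) auto
          finally show "norm (f y - f x - (y - x) *\<^sub>R g x) \<le> e * norm (y - x)" by simp
        qed
      qed
    qed
  qed
qed

section \<open>Inverting the Caputo derivative\<close>

text \<open>Supplies measurability of integrands that contain \<open>vector_derivative\<close>,
  about which only almost-everywhere equality with a Borel function is known.\<close>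

lemma borel_measurable_completion_AE:
  fixes f g :: "'b \<Rightarrow> 'c::topological_space"
  assumes f: "f \<in> borel_measurable M" and eq: "AE x in M. f x = g x"
  shows "g \<in> borel_measurable (completion M)"
proof (rule borel_measurableI)
  fix S :: "'c set" assume "open S"
  then have "f -` S \<inter> space (completion M) \<in> sets (completion M)"
    using measurable_sets[OF measurable_completion[OF f], of S] by simp
  then have "Measurable.pred (completion M) (\<lambda>x. f x \<in> S)"
    by (simp add: pred_def vimage_def Int_def conj_commute)
  moreover have "Measurable.pred (completion M) (\<lambda>x. f x \<noteq> g x)"
    by (rule sets_completion_AE) (use eq in auto)
  moreover have "Measurable.pred (completion M) (\<lambda>x. f x \<noteq> g x \<and> g x \<in> S)"
    by (rule sets_completion_AE) (use eq in \<open>auto elim: eventually_mono\<close>)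
  \<comment> \<open>The preimage under \<open>g\<close> splits into a part where
    \<open>f = g\<close>, governed by \<open>f\<close>, and a subset of a null set, measurable by
    completeness.\<close>
  ultimately have *: "Measurable.pred (completion M) (\<lambda>x. (f x \<in> S \<and> \<not> f x \<noteq> g x) \<or> (f x \<noteq> g x \<and> g x \<in> S))"
    by measurable
  have "(\<lambda>x. (f x \<in> S \<and> \<not> f x \<noteq> g x) \<or> (f x \<noteq> g x \<and> g x \<in> S)) = (\<lambda>x. g x \<in> S)" by auto
  from *[unfolded this] show "g -` S \<inter> space (completion M) \<in> sets (completion M)"
    by (simp add: pred_def vimage_def Int_def conj_commute)
qed

lemma integral_completion_AE:
  fixes f g :: "'b \<Rightarrow> 'c::{banach, second_countable_topology}"
  assumes f: "f \<in> borel_measurable M" and eq: "AE x in M. f x = g x"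
  shows "integral\<^sup>L (completion M) g = integral\<^sup>L M f"
proof -
  have "integral\<^sup>L (completion M) g = integral\<^sup>L (completion M) f"
    using borel_measurable_completion_AE[OF f eq] measurable_completion[OF f] eq
    by (intro integral_cong_AE) (auto simp: AE_completion_iff elim: eventually_mono)
  then show ?thesis using integral_completion[OF f] by simp
qed

text \<open>The substitution s = r + (t-r)x leads to the Beta integral B(1-\<alpha>, \<alpha>),
  where Gamma(1) = 1. The value does not depend on \<open>r\<close> or \<open>t\<close>.\<close>

lemma has_bochner_integral_Beta_kernel:
  fixes r t \<alpha> :: real
  assumes rt: "r < t" and \<alpha>: "0 < \<alpha>" "\<alpha> < 1"
  shows "has_bochner_integral lborel
    (\<lambda>s. indicator {r<..<t} s * ((t - s) powr (\<alpha> - 1) * (s - r) powr (- \<alpha>))) (Gamma \<alpha> * Gamma (1 - \<alpha>))"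
proof -
  let ?h = "\<lambda>x. x powr (- \<alpha>) * (1 - x) powr (\<alpha> - 1)"
  have int: "set_integrable lborel {0..1} ?h"
    using integrable_Beta[of "1 - \<alpha>" \<alpha>] \<alpha> by simp
  moreover have "(LINT x:{0..1}|lborel. ?h x) = Gamma \<alpha> * Gamma (1 - \<alpha>)"
    using set_borel_integral_eq_integral(2)[OF int] has_integral_Beta_real[of "1 - \<alpha>" \<alpha>, THEN integral_unique] \<alpha>
    by (simp add: Beta_def mult.commute)
  ultimately have "has_bochner_integral lborel (\<lambda>x. indicator {0..1} x *\<^sub>R ?h x) (Gamma \<alpha> * Gamma (1 - \<alpha>))"
    unfolding has_bochner_integral_iff set_integrable_def set_lebesgue_integral_def by blast
  then have "has_bochner_integral lborel (\<lambda>x. inverse (t - r) * (indicator {0..1} x *\<^sub>R ?h x)) (inverse (t - r) * (Gamma \<alpha> * Gamma (1 - \<alpha>)))"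
    by (rule has_bochner_integral_mult_right)
  moreover have "inverse (t - r) * (indicator {0..1} x *\<^sub>R ?h x)
      = indicator {r<..<t} (r + (t - r) * x) * ((t - (r + (t - r) * x)) powr (\<alpha> - 1) * (r + (t - r) * x - r) powr (- \<alpha>))"
    for x
  proof (cases "0 < x \<and> x < 1")
    case True
    have "(t - r) * x < (t - r) * 1" "(t - r) * x > 0"
      using True rt by (intro mult_strict_left_mono mult_pos_pos; simp)+
    then have i: "indicator {r<..<t} (r + (t - r) * x) = (1::real)" by auto
    have e: "t - (r + (t - r) * x) = (t - r) * (1 - x)" by (simp add: algebra_simps)
    \<comment> \<open>The exponents add up to -1, which matches the Jacobian of the
      substitution.\<close>
    have "(t - r) powr (\<alpha> - 1) * (t - r) powr (- \<alpha>) = inverse (t - r)"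
      using rt by (subst powr_add[symmetric]) (simp add: powr_minus)
    then show ?thesis unfolding i e using True rt by (simp add: powr_mult mult_ac)
  next
    case False
    have "\<not> (r < r + (t - r) * x \<and> r + (t - r) * x < t)"
    proof
      assume *: "r < r + (t - r) * x \<and> r + (t - r) * x < t"
      then have "(t - r) * x > 0" "(t - r) * x < (t - r) * 1" by (auto simp: algebra_simps)
      then show False using False rt by (auto simp only: zero_less_mult_iff mult_less_cancel_left)
    qed
    \<comment> \<open>At x = 0 and x = 1 the convention that \<open>0 powr\<close> anything is 0
      makes the closed indicator harmless.\<close>
    moreover have "indicator {0..1} x *\<^sub>R ?h x = 0"
      using False by (auto split: split_indicator)
    ultimately show ?thesis by auto
  qed
  ultimately show ?thesis
    using rt by (subst lborel_has_bochner_integral_real_affine_iff[where c="t - r" and t=r]) (auto simp: divide_inverse)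
qed

text \<open>Up to the Gamma factors, this is \<open>I\<^sup>\<alpha> I\<^bsup>1 - \<alpha>\<^esup> = I\<^sup>1\<close> for Riemann--Liouville integrals.\<close>

lemma RL_kernel_semigroup:
  fixes f :: "real \<Rightarrow> 'a::euclidean_space"
  assumes f: "integrable lborel f" and \<alpha>: "0 < \<alpha>" "\<alpha> < 1"
  shows "(LINT s:{a<..<t}|lborel. (t - s) powr (\<alpha> - 1) *\<^sub>R (LINT r:{a<..<s}|lborel. (s - r) powr (- \<alpha>) *\<^sub>R f r))
    = (Gamma \<alpha> * Gamma (1 - \<alpha>)) *\<^sub>R (LINT r:{a<..<t}|lborel. f r)"
proof -
  have [measurable]: "f \<in> borel_measurable borel" using borel_measurable_integrable[OF f] by simp
  define k where "k = (\<lambda>r s. indicator {r<..<t} s * ((t - s) powr (\<alpha> - 1) * (s - r) powr (- \<alpha>)))"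
  define H where "H = (\<lambda>r s. (indicator {a<..<t} r * k r s) *\<^sub>R f r)"
  let ?C = "Gamma \<alpha> * Gamma (1 - \<alpha>)"
  have k_nonneg: "k r s \<ge> 0" for r s by (simp add: k_def)
  have k: "has_bochner_integral lborel (\<lambda>s. indicator {a<..<t} r * k r s) (indicator {a<..<t} r * ?C)" for r
    using has_bochner_integral_Beta_kernel[of r t \<alpha>] \<alpha>
    by (cases "a < r \<and> r < t") (auto simp: k_def)
  have H_int: "integrable lborel (H r)" for r
    using k[of r] unfolding H_def has_bochner_integral_iff by auto
  have [measurable]: "case_prod k \<in> borel_measurable (borel \<Otimes>\<^sub>M borel)"
  proof -
    \<comment> \<open>The interval depends on \<open>r\<close>; a conditional in place of its
      indicator exposes joint measurability.\<close>
    have "case_prod k = (\<lambda>p. (if fst p < snd p \<and> snd p < t then 1 else 0) * ((t - snd p) powr (\<alpha> - 1) * (snd p - fst p) powr (- \<alpha>)))"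
      unfolding k_def by (auto simp: fun_eq_iff)
    also have "\<dots> \<in> borel_measurable (borel \<Otimes>\<^sub>M borel)" by measurable
    finally show ?thesis .
  qed
  \<comment> \<open>As \<open>k\<close> is nonnegative, integrating the norm over \<open>s\<close>
    gives the constant \<open>?C\<close> times \<open>norm (f r)\<close> on \<open>{a<..<t}\<close>,
    which is integrable in \<open>r\<close>.\<close>
  have "integrable (lborel \<Otimes>\<^sub>M lborel) (\<lambda>p. H (fst p) (snd p))"
  proof (rule lborel_pair.Fubini_integrable)
    have "(\<lambda>p. H (fst p) (snd p)) = (\<lambda>p. (indicator {a<..<t} (fst p) * case_prod k p) *\<^sub>R f (fst p))"
      by (auto simp: H_def fun_eq_iff)
    also have "\<dots> \<in> borel_measurable (borel \<Otimes>\<^sub>M borel)" by measurable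
    finally show "(\<lambda>p. H (fst p) (snd p)) \<in> borel_measurable (lborel \<Otimes>\<^sub>M lborel)"
      by (simp cong: measurable_cong_sets sets_pair_measure_cong)
    have "(LINT s|lborel. norm (H r s)) = indicator {a<..<t} r * ?C * norm (f r)" for r
    proof -
      have "(LINT s|lborel. norm (H r s)) = (LINT s|lborel. (indicator {a<..<t} r * k r s) * norm (f r))"
        using k_nonneg by (simp add: H_def abs_mult)
      then show ?thesis using k[of r] unfolding has_bochner_integral_iff by simp
    qed
    moreover have "integrable lborel (\<lambda>r. indicator {a<..<t} r *\<^sub>R (?C * norm (f r)))"
      using f by (intro integrable_mult_indicator) auto
    ultimately show "integrable lborel (\<lambda>r. LINT s|lborel. norm (H (fst (r, s)) (snd (r, s))))"
      by (simp add: mult.assoc)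
    show "AE r in lborel. integrable lborel (\<lambda>s. H (fst (r, s)) (snd (r, s)))"
      using H_int by simp
  qed
  then have "(LINT s|lborel. (LINT r|lborel. H r s)) = (LINT r|lborel. (LINT s|lborel. H r s))"
    by (intro lborel_pair.Fubini_integral) (simp add: case_prod_beta')
  moreover have "(LINT s|lborel. H r s) = ?C *\<^sub>R (indicator {a<..<t} r *\<^sub>R f r)" for r
    using k[of r] unfolding H_def has_bochner_integral_iff by (simp add: mult.commute)
  moreover have "(LINT r|lborel. H r s)
     = indicator {a<..<t} s *\<^sub>R ((t - s) powr (\<alpha> - 1) *\<^sub>R (LINT r:{a<..<s}|lborel. (s - r) powr (- \<alpha>) *\<^sub>R f r))" for s
  proof -
    have "H r s = (indicator {a<..<t} s * (t - s) powr (\<alpha> - 1)) *\<^sub>R (indicator {a<..<s} r *\<^sub>R ((s - r) powr (- \<alpha>) *\<^sub>R f r))" for r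
      by (auto simp: H_def k_def split: split_indicator)
    then show ?thesis unfolding set_lebesgue_integral_def by (simp only: integral_scaleR_right) simp
  qed
  ultimately show ?thesis unfolding set_lebesgue_integral_def
    by (simp only: integral_scaleR_right)
qed

text \<open>The composite of the two fractional integrals is the ordinary integral of
  \<open>g\<close>, which is \<open>u t\<close> because \<open>u a = 0\<close>.\<close>

lemma AC_on_eq_RL_integral_caputo:
  fixes u :: "real \<Rightarrow> 'a::euclidean_space"
  assumes AC: "AC_on a b u" and ab: "a < b" and u0: "u a = 0" and \<alpha>: "0 < \<alpha>" "\<alpha> \<le> 1"
    and t: "t \<in> {a<..<b}"
  shows "u t = RL_integral a \<alpha> (caputo a \<alpha> u) t"
proof -
  obtain g where g: "has_density a b u g" using AC_on_density[OF AC] ab by auto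
  have g_int: "integrable lborel g" and gu: "\<And>x. x \<in> {a..b} \<Longrightarrow> (LINT s:{a<..x}|lborel. g s) = u x - u a"
    using g unfolding has_density_def by auto
  have g_meas [measurable]: "g \<in> borel_measurable borel" using borel_measurable_integrable[OF g_int] by simp
  have gu': "(LINT s:{a<..<t}|lborel. g s) = u t"
  proof -
    have "(LINT s:{a<..<t}|lborel. g s) = (LINT s:{a<..t}|lborel. g s)"
      unfolding set_lebesgue_integral_def
    proof (rule integral_cong_AE)
      show "AE s in lborel. indicator {a<..<t} s *\<^sub>R g s = indicator {a<..t} s *\<^sub>R g s"
        using AE_lborel_singleton[of t] by eventually_elim (auto split: split_indicator)
    qed auto
    then show ?thesis using gu[of t] t u0 by simp
  qed
  have AE_g: "AE x in lborel. a < x \<longrightarrow> x < b \<longrightarrow> vector_derivative u (at x) = g x"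
    using has_density_AE_vector_derivative[OF g ab] by eventually_elim (auto intro: vector_derivative_at)
  show ?thesis
  \<comment> \<open>For \<alpha> = 1 the Caputo derivative is the derivative itself by the
    order-zero clause of \<open>RL_integral\<close>; the Beta integral would meet the pole of Gamma
    at 0.\<close>
  proof (cases "\<alpha> = 1")
    case True
    have cap: "caputo a \<alpha> u = (\<lambda>s. vector_derivative u (at s))"
      by (auto simp: caputo_def RL_integral_def True fun_eq_iff)
    have "(LINT s:{a<..<t}|lebesgue. (t - s) powr (\<alpha> - 1) *\<^sub>R caputo a \<alpha> u s) = (LINT s:{a<..<t}|lborel. g s)"
      unfolding set_lebesgue_integral_def
    proof (rule integral_completion_AE)
      show "AE s in lborel. indicator {a<..<t} s *\<^sub>R g s = indicator {a<..<t} s *\<^sub>R ((t - s) powr (\<alpha> - 1) *\<^sub>R caputo a \<alpha> u s)"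
        unfolding cap using AE_g by eventually_elim (use t True in \<open>auto split: split_indicator\<close>)
    qed auto
    then show ?thesis using gu' by (simp add: RL_integral_def True)
  next
    case False
    with \<alpha> have \<alpha>1: "\<alpha> < 1" by simp
    define w where "w = (\<lambda>s. LINT r:{a<..<s}|lborel. (s - r) powr (- \<alpha>) *\<^sub>R g r)"
    \<comment> \<open>Holds at every \<open>s\<close>, not just almost every: derivative and density
      are exchanged only under the integral.\<close>
    have cap: "caputo a \<alpha> u s = (1 / Gamma (1 - \<alpha>)) *\<^sub>R w s" if s: "s \<in> {a<..<b}" for s
    proof -
      have "(LINT r:{a<..<s}|lebesgue. (s - r) powr (- \<alpha>) *\<^sub>R vector_derivative u (at r)) = w s"
        unfolding w_def set_lebesgue_integral_def
      proof (rule integral_completion_AE)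
        show "AE r in lborel. indicator {a<..<s} r *\<^sub>R ((s - r) powr (- \<alpha>) *\<^sub>R g r)
            = indicator {a<..<s} r *\<^sub>R ((s - r) powr (- \<alpha>) *\<^sub>R vector_derivative u (at r))"
          using AE_g by eventually_elim (use s in \<open>auto split: split_indicator\<close>)
      qed auto
      then show ?thesis using \<alpha>1 by (simp add: caputo_def RL_integral_def)
    qed
    have w_meas [measurable]: "w \<in> borel_measurable borel"
    proof -
      have "(\<lambda>s. LINT r|lborel. (if a < r \<and> r < s then 1 else 0) *\<^sub>R ((s - r) powr (- \<alpha>) *\<^sub>R g r)) \<in> borel_measurable borel"
        by measurable
      also have "(\<lambda>s. LINT r|lborel. (if a < r \<and> r < s then 1 else 0) *\<^sub>R ((s - r) powr (- \<alpha>) *\<^sub>R g r)) = w"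
        unfolding w_def set_lebesgue_integral_def by (auto simp: fun_eq_iff intro!: Bochner_Integration.integral_cong)
      finally show ?thesis .
    qed
    have "(LINT s:{a<..<t}|lebesgue. (t - s) powr (\<alpha> - 1) *\<^sub>R caputo a \<alpha> u s)
        = (LINT s:{a<..<t}|lborel. (1 / Gamma (1 - \<alpha>)) *\<^sub>R ((t - s) powr (\<alpha> - 1) *\<^sub>R w s))"
      unfolding set_lebesgue_integral_def
    proof (rule integral_completion_AE)
      show "AE s in lborel. indicator {a<..<t} s *\<^sub>R ((1 / Gamma (1 - \<alpha>)) *\<^sub>R ((t - s) powr (\<alpha> - 1) *\<^sub>R w s))
          = indicator {a<..<t} s *\<^sub>R ((t - s) powr (\<alpha> - 1) *\<^sub>R caputo a \<alpha> u s)"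
        using t by (auto simp: cap split: split_indicator)
    qed auto
    also have "\<dots> = (1 / Gamma (1 - \<alpha>)) *\<^sub>R (LINT s:{a<..<t}|lborel. (t - s) powr (\<alpha> - 1) *\<^sub>R w s)"
      by (rule set_integral_scaleR_right)
    also have "(LINT s:{a<..<t}|lborel. (t - s) powr (\<alpha> - 1) *\<^sub>R w s) = (Gamma \<alpha> * Gamma (1 - \<alpha>)) *\<^sub>R u t"
      unfolding w_def using RL_kernel_semigroup[OF g_int \<alpha>(1) \<alpha>1, of a t] gu' by simp
    also have "(1 / Gamma (1 - \<alpha>)) *\<^sub>R \<dots> = Gamma \<alpha> *\<^sub>R u t"
      using Gamma_real_pos[of "1 - \<alpha>"] \<alpha>1 by (auto simp: less_le)
    finally show ?thesis using \<alpha> Gamma_real_pos[of \<alpha>] by (auto simp: RL_integral_def less_le)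
  qed
qed

section \<open>Estimates in Lebesgue norms\<close>

text \<open>Young's inequality is applied to \<open>h\<close> and \<open>k\<close> divided by their
  L^q and L^p norms.\<close>

lemma Holder_integral:
  fixes h k :: "'b \<Rightarrow> real"
  assumes pq: "p > 1" "q > 1" "1 / p + 1 / q = 1"
    and nonneg: "\<And>x. h x \<ge> 0" "\<And>x. k x \<ge> 0"
    and int: "integrable M (\<lambda>x. h x powr q)" "integrable M (\<lambda>x. k x powr p)"
  shows "(LINT x|M. h x * k x) \<le> (LINT x|M. h x powr q) powr (1 / q) * (LINT x|M. k x powr p) powr (1 / p)"
proof -
  define A B where "A = (LINT x|M. h x powr q)" and "B = (LINT x|M. k x powr p)"
  have AB: "A \<ge> 0" "B \<ge> 0" unfolding A_def B_def by auto
  show ?thesis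
  \<comment> \<open>If a norm vanishes, normalisation is impossible, but then the product is 0
    almost everywhere.\<close>
  proof (cases "A = 0 \<or> B = 0")
    case True
    have "AE x in M. h x * k x = 0"
    proof (cases "A = 0")
      case True
      then have "AE x in M. h x powr q = 0"
        unfolding A_def by (subst (asm) integral_nonneg_eq_0_iff_AE[OF int(1)]) auto
      then show ?thesis by eventually_elim auto
    next
      case False
      with \<open>A = 0 \<or> B = 0\<close> have "AE x in M. k x powr p = 0"
        unfolding B_def by (subst (asm) integral_nonneg_eq_0_iff_AE[OF int(2)]) auto
      then show ?thesis by eventually_elim auto
    qed
    then have "(LINT x|M. h x * k x) = 0" by (rule integral_eq_zero_AE)
    then show ?thesis by simp
  next
    case False
    with AB have pos: "A > 0" "B > 0" by auto
    define c where "c = A powr (1 / q) * B powr (1 / p)"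
    have c: "c > 0" using pos by (simp add: c_def)
    have le: "h x * k x \<le> c * (h x powr q / A / q + k x powr p / B / p)" for x
    proof -
      have "(h x / A powr (1 / q)) * (k x / B powr (1 / p))
          \<le> (h x / A powr (1 / q)) powr q / q + (k x / B powr (1 / p)) powr p / p"
        using pq nonneg pos by (intro Youngs_inequality) (auto simp: add.commute)
      also have "(h x / A powr (1 / q)) powr q = h x powr q / A"
        using nonneg pos pq by (simp add: powr_divide powr_powr)
      also have "(k x / B powr (1 / p)) powr p = k x powr p / B"
        using nonneg pos pq by (simp add: powr_divide powr_powr)
      finally show ?thesis
        using c unfolding c_def by (simp add: field_simps)
    qed
    \<comment> \<open>Only the majorant is known to be integrable. If the product is not, its
      integral is 0 by default and the bound holds since the majorant is nonnegative.\<close>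
    have "(LINT x|M. h x * k x) \<le> (LINT x|M. c * (h x powr q / A / q + k x powr p / B / p))"
      using le c pos pq int by (intro integral_mono') (auto intro!: mult_nonneg_nonneg add_nonneg_nonneg)
    also have "\<dots> = c * (A / A / q + B / B / p)"
      using int by (simp add: A_def B_def)
    also have "\<dots> = c" using pos pq by (simp add: add.commute)
    finally show ?thesis unfolding c_def A_def B_def .
  qed
qed

text \<open>The reflection x = t - s reduces this to the integral of a power from 0.\<close>

lemma has_bochner_integral_powr_kernel:
  fixes a t \<beta> :: real
  assumes at: "a \<le> t" and \<beta>: "\<beta> > 0"
  shows "has_bochner_integral lborel (\<lambda>s. indicator {a..t} s * (t - s) powr (\<beta> - 1)) ((t - a) powr \<beta> / \<beta>)"
proof -
  have "((\<lambda>x. x powr (\<beta> - 1)) has_integral (t - a) powr \<beta> / \<beta>) {0..t - a}"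
    using has_integral_powr_from_0[of "\<beta> - 1" "t - a"] assms by simp
  then have "(\<integral>\<^sup>+x. ennreal (indicator {0..t - a} x * x powr (\<beta> - 1)) \<partial>lborel) = ennreal ((t - a) powr \<beta> / \<beta>)"
    by (intro nn_integral_has_integral_lebesgue) auto
  then have "has_bochner_integral lborel (\<lambda>x. indicator {0..t - a} x * x powr (\<beta> - 1)) ((t - a) powr \<beta> / \<beta>)"
    using \<beta> by (intro has_bochner_integral_nn_integral) auto
  moreover have "(\<lambda>x. indicator {0..t - a} x * x powr (\<beta> - 1))
      = (\<lambda>x. indicator {a..t} (t + (-1) * x) * (t - (t + (-1) * x)) powr (\<beta> - 1))"
    by (auto simp: fun_eq_iff split: split_indicator)
  ultimately show ?thesis
    by (subst lborel_has_bochner_integral_real_affine_iff[where c="-1" and t=t]) auto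
qed

lemma norm_RL_integral_le:
  fixes c :: "real \<Rightarrow> 'a::{banach, second_countable_topology}"
  assumes pq: "p > 1" "q = p / (p - 1)" and \<alpha>: "1 / p < \<alpha>"
    and c: "in_Lp p a b c" and t: "t \<in> {a<..<b}"
  shows "norm (RL_integral a \<alpha> c t)
    \<le> (b - a) powr (\<alpha> - 1 / p) / ((\<alpha> * q - q + 1) powr (1 / q) * Gamma \<alpha>) * Lp_norm p a b c"
proof -
  \<comment> \<open>\<beta> - 1 = (\<alpha>-1)q is the exponent of the q-th power of the kernel, and
    \<beta>/q = \<alpha> - 1/p, so \<beta> is positive by the assumption on \<alpha>.\<close>
  define \<beta> where "\<beta> = \<alpha> * q - q + 1"
  have q: "q > 1" "1 / p + 1 / q = 1" using pq(1) by (simp_all add: pq(2) field_simps)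
  have "\<alpha> > 0" using \<alpha> pq by (meson less_trans zero_less_divide_1_iff zero_less_one)
  have \<beta>_q: "\<beta> / q = \<alpha> - 1 / p"
  proof -
    have "\<beta> / q = \<alpha> - 1 + 1 / q" using q(1) by (simp add: \<beta>_def field_simps)
    then show ?thesis using q(2) by simp
  qed
  with \<alpha> q(1) have \<beta>: "\<beta> > 0" by (metis diff_gt_0_iff_gt zero_less_divide_iff less_trans zero_less_one not_less_iff_gr_or_eq)
  define h where "h = (\<lambda>s. indicator {a..t} s * (t - s) powr (\<alpha> - 1))"
  define k where "k = (\<lambda>s. indicator {a<..<b} s * norm (c s))"
  have h_q: "h s powr q = indicator {a..t} s * (t - s) powr (\<beta> - 1)" for s
    by (auto simp: h_def \<beta>_def powr_powr left_diff_distrib split: split_indicator)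
  have h_int: "has_bochner_integral lebesgue (\<lambda>s. h s powr q) ((t - a) powr \<beta> / \<beta>)"
    unfolding h_q using has_bochner_integral_powr_kernel[of a t \<beta>] t \<beta>
    by (simp add: has_bochner_integral_iff integrable_completion integral_completion)
  have k_p: "k s powr p = indicator {a<..<b} s *\<^sub>R norm (c s) powr p" for s
    by (auto simp: k_def split: split_indicator)
  have k_int: "integrable lebesgue (\<lambda>s. k s powr p)"
    using c unfolding k_p in_Lp_def set_integrable_def by blast
  have "norm (LINT s:{a<..<t}|lebesgue. (t - s) powr (\<alpha> - 1) *\<^sub>R c s)
      \<le> (LINT s|lebesgue. norm (indicator {a<..<t} s *\<^sub>R ((t - s) powr (\<alpha> - 1) *\<^sub>R c s)))"
    unfolding set_lebesgue_integral_def by (rule integral_norm_bound)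
  \<comment> \<open>The product vanishes at both ends of \<open>{a..t}\<close>: \<open>k\<close> is
    0 at \<open>a\<close>, and the kernel is \<open>0 powr (\<alpha> - 1) = 0\<close> at
    \<open>t\<close>.\<close>
  also have "\<dots> = (LINT s|lebesgue. h s * k s)"
    using t by (intro Bochner_Integration.integral_cong refl) (auto simp: h_def k_def split: split_indicator)
  also have "\<dots> \<le> (LINT s|lebesgue. h s powr q) powr (1 / q) * (LINT s|lebesgue. k s powr p) powr (1 / p)"
    using h_int k_int by (intro Holder_integral pq(1) q) (auto simp: h_def k_def has_bochner_integral_iff)
  also have "(LINT s|lebesgue. k s powr p) powr (1 / p) = Lp_norm p a b c"
    unfolding Lp_norm_def set_lebesgue_integral_def k_p ..
  also have "(LINT s|lebesgue. h s powr q) powr (1 / q) = (t - a) powr (\<beta> / q) / \<beta> powr (1 / q)"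
    using h_int t \<beta> by (simp add: has_bochner_integral_iff powr_divide powr_powr)
  also have "(t - a) powr (\<beta> / q) \<le> (b - a) powr (\<beta> / q)"
    using t \<beta> q(1) by (intro powr_mono2) auto
  finally have "norm (LINT s:{a<..<t}|lebesgue. (t - s) powr (\<alpha> - 1) *\<^sub>R c s)
      \<le> (b - a) powr (\<beta> / q) / \<beta> powr (1 / q) * Lp_norm p a b c"
    by (simp add: divide_right_mono mult_right_mono Lp_norm_def)
  note le = this
  have "norm (RL_integral a \<alpha> c t) = 1 / Gamma \<alpha> * norm (LINT s:{a<..<t}|lebesgue. (t - s) powr (\<alpha> - 1) *\<^sub>R c s)"
    using \<open>\<alpha> > 0\<close> by (simp add: RL_integral_def)
  also have "\<dots> \<le> 1 / Gamma \<alpha> * ((b - a) powr (\<beta> / q) / \<beta> powr (1 / q) * Lp_norm p a b c)"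
    using \<open>\<alpha> > 0\<close> by (intro mult_left_mono le) auto
  also have "\<dots> = (b - a) powr (\<beta> / q) / (\<beta> powr (1 / q) * Gamma \<alpha>) * Lp_norm p a b c"
    by simp
  finally show ?thesis unfolding \<beta>_q unfolding \<beta>_def .
qed

lemma Lp_norm_le_of_bounded:
  fixes f :: "real \<Rightarrow> 'a::real_normed_vector"
  assumes "a \<le> b" "p > 0" "M \<ge> 0" and f: "\<And>x. x \<in> {a<..<b} \<Longrightarrow> norm (f x) \<le> M"
  shows "Lp_norm p a b f \<le> M * (b - a) powr (1 / p)"
proof -
  have "(LINT x:{a<..<b}|lebesgue. norm (f x) powr p) \<le> (LINT x|lebesgue. indicator {a<..<b} x * M powr p)"
    unfolding set_lebesgue_integral_def
  proof (rule integral_mono')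
    show "integrable lebesgue (\<lambda>x. indicator {a<..<b} x * M powr p)"
      by (intro integrable_mult_left) (auto intro!: integrable_real_indicator simp: assms)
  qed (use assms in \<open>auto intro!: powr_mono2 split: split_indicator\<close>)
  also have "\<dots> = (b - a) * M powr p" using assms(1) by simp
  finally have "Lp_norm p a b f \<le> ((b - a) * M powr p) powr (1 / p)"
    unfolding Lp_norm_def using assms(2)
    by (intro powr_mono2) (auto simp: set_lebesgue_integral_def)
  also have "\<dots> = M * (b - a) powr (1 / p)"
    using assms by (simp add: powr_mult powr_powr)
  finally show ?thesis .
qed

text \<open>The weighted function stands on the larger side, where the default value 0 of a
  divergent integral would break the estimate. Its integrability is secured by \<open>D\<close>,
  while \<open>C\<close> alone enters the bound.\<close>

lemma Lp_norm_le_weighted: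
  fixes f :: "real \<Rightarrow> 'a::real_normed_vector"
  assumes p: "p > 0" and f: "in_Lp p a b f" and C: "C \<ge> 0" and [measurable]: "w \<in> borel_measurable borel"
    and w: "\<And>x. x \<in> {a<..<b} \<Longrightarrow> 0 < w x \<and> w x \<le> C" "\<And>x. x \<in> {a<..<b} \<Longrightarrow> inverse (w x) \<le> D"
  shows "Lp_norm p a b f \<le> C * Lp_norm p a b (\<lambda>x. f x /\<^sub>R w x)"
proof -
  let ?F = "\<lambda>x. indicator {a<..<b} x *\<^sub>R norm (f x) powr p"
  let ?G = "\<lambda>x. indicator {a<..<b} x *\<^sub>R norm (f x /\<^sub>R w x) powr p"
  have F: "integrable lebesgue ?F" using f unfolding in_Lp_def set_integrable_def by blast
  have G_eq: "?G x = inverse (w x) powr p * ?F x" for x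
    using w(1)[of x] by (auto simp: powr_mult split: split_indicator)
  have "integrable lebesgue ?G"
  proof (rule Bochner_Integration.integrable_bound)
    show "integrable lebesgue (\<lambda>x. D powr p * ?F x)" using F by (rule integrable_mult_right)
    have "(\<lambda>x. inverse (w x) powr p) \<in> borel_measurable lebesgue"
      by (rule measurable_completion) simp
    then show "?G \<in> borel_measurable lebesgue"
      unfolding G_eq using borel_measurable_integrable[OF F] by (rule borel_measurable_times)
    show "AE x in lebesgue. norm (?G x) \<le> norm (D powr p * ?F x)"
      unfolding G_eq using w p
      by (intro AE_I2) (auto split: split_indicator intro!: mult_right_mono powr_mono2 simp: abs_mult less_imp_le)
  qed
  moreover have "?F x \<le> C powr p * ?G x" for x
  proof (cases "x \<in> {a<..<b}")
    case True
    have "norm (f x) = w x * norm (f x /\<^sub>R w x)" using w(1)[OF True] by simp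
    also have "\<dots> \<le> C * norm (f x /\<^sub>R w x)" using w(1)[OF True] by (intro mult_right_mono) auto
    finally have "norm (f x) powr p \<le> (C * norm (f x /\<^sub>R w x)) powr p" using p by (intro powr_mono2) auto
    also have "\<dots> = C powr p * norm (f x /\<^sub>R w x) powr p" by (rule powr_mult)
    finally show ?thesis using True by simp
  qed simp
  ultimately have "(LINT x|lebesgue. ?F x) \<le> (LINT x|lebesgue. C powr p * ?G x)"
    using F by (intro integral_mono integrable_mult_right)
  also have "\<dots> = C powr p * (LINT x|lebesgue. ?G x)" by (rule integral_mult_right_zero)
  finally have "(LINT x|lebesgue. ?F x) \<le> C powr p * (LINT x|lebesgue. ?G x)" .
  then have "Lp_norm p a b f \<le> (C powr p * (LINT x|lebesgue. ?G x)) powr (1 / p)"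
    unfolding Lp_norm_def set_lebesgue_integral_def using p by (intro powr_mono2) auto
  also have "\<dots> = C * Lp_norm p a b (\<lambda>x. f x /\<^sub>R w x)"
    unfolding Lp_norm_def set_lebesgue_integral_def using p C by (subst powr_mult) (auto simp: powr_powr)
  finally show ?thesis .
qed

section \<open>The weighted inequality and its constant\<close>

theorem theorem3p8:
  fixes a b p q \<alpha> \<gamma> :: real
    and u :: "real \<Rightarrow> 'a::{real_normed_field, euclidean_space}"
  assumes "0 < a" and "a < b"
    and "p > 1" and "q = p / (p - 1)"
    and "1 / p < \<alpha>" and "\<alpha> \<le> 1"
    and "AC_on a b u"
    and "in_Lp p a b u"
    and "u a = 0"
    and "in_Lp p a b (caputo a \<alpha> u)"
  shows "Lp_norm p a b (\<lambda>x. u x /\<^sub>R (x powr (\<gamma> + 1)))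
      \<le> (a powr (- \<bar>\<gamma>\<bar> - 1) * b powr \<bar>\<gamma>\<bar> * (b - a) powr \<alpha>)
          / ((\<alpha> * q - q + 1) powr (1 / q) * Gamma \<alpha>)
        * Lp_norm p a b (\<lambda>x. caputo a \<alpha> u x /\<^sub>R (x powr \<gamma>))"
proof -
  let ?c = "caputo a \<alpha> u"
  define K where "K = (\<alpha> * q - q + 1) powr (1 / q) * Gamma \<alpha>"
  define N where "N = Lp_norm p a b (\<lambda>x. ?c x /\<^sub>R (x powr \<gamma>))"
  have \<alpha>: "\<alpha> > 0" using assms(3,5) by (meson less_trans zero_less_divide_1_iff zero_less_one)
  have K: "K \<ge> 0" using Gamma_real_pos[OF \<alpha>] by (simp add: K_def)
  have N: "N \<ge> 0" by (simp add: N_def Lp_norm_def)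
  \<comment> \<open>Powers are monotone on \<open>{a..b}\<close>, so the two maxima sit at opposite
    ends whatever the sign of \<gamma>; this is why the product involves only
    \<bar>\<gamma>\<bar>.\<close>
  define C D where "C = max (a powr \<gamma>) (b powr \<gamma>)" and "D = max (a powr (- \<gamma>)) (b powr (- \<gamma>))"
  have CD: "C * D = a powr (- \<bar>\<gamma>\<bar>) * b powr \<bar>\<gamma>\<bar>"
  proof (cases "\<gamma> \<ge> 0")
    case True
    then have "a powr \<gamma> \<le> b powr \<gamma>" "b powr (- \<gamma>) \<le> a powr (- \<gamma>)"
      using powr_mono2[of \<gamma> a b] powr_mono2'[of "- \<gamma>" a b] assms(1,2) by auto
    then show ?thesis using True by (simp add: C_def D_def max_def)
  next
    case False
    then have "b powr \<gamma> \<le> a powr \<gamma>" "a powr (- \<gamma>) \<le> b powr (- \<gamma>)"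
      using powr_mono2'[of \<gamma> a b] powr_mono2[of "- \<gamma>" a b] assms(1,2) by auto
    then show ?thesis using False by (auto simp: C_def D_def max_def)
  qed
  have C: "x powr \<gamma> \<le> C" and D: "x powr (- \<gamma>) \<le> D" if "x \<in> {a<..<b}" for x
    using that assms(1) powr_mono2[of \<gamma> x b] powr_mono2'[of \<gamma> a x] powr_mono2[of "- \<gamma>" x b] powr_mono2'[of "- \<gamma>" a x]
    unfolding C_def D_def by (cases "\<gamma> \<ge> 0"; force simp: max_def)+
  have C0: "C \<ge> 0" "D \<ge> 0" by (auto simp: C_def D_def le_max_iff_disj)
  have c_le: "Lp_norm p a b ?c \<le> C * N"
    unfolding N_def
  proof (rule Lp_norm_le_weighted[where D = D])
    show "inverse (x powr \<gamma>) \<le> D" if "x \<in> {a<..<b}" for x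
      using D[OF that] by (simp add: powr_minus)
  qed (use assms C C0 in auto)
  \<comment> \<open>The pointwise Hoelder bound, with \<open>C\<close> paying for the weight put on
    the Caputo derivative.\<close>
  define M where "M = (b - a) powr (\<alpha> - 1 / p) / K * (C * N)"
  have u_le: "norm (u x) \<le> M" if x: "x \<in> {a<..<b}" for x
  proof -
    have "norm (u x) = norm (RL_integral a \<alpha> ?c x)"
      using AC_on_eq_RL_integral_caputo[OF assms(7,2,9) \<alpha> assms(6) x] by simp
    also have "\<dots> \<le> (b - a) powr (\<alpha> - 1 / p) / K * Lp_norm p a b ?c"
      unfolding K_def by (rule norm_RL_integral_le[OF assms(3,4,5,10) x])
    also have "\<dots> \<le> M" unfolding M_def using c_le K by (intro mult_left_mono) auto
    finally show ?thesis .
  qed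
  \<comment> \<open>\<open>D\<close> bounds the factor x^(-\<gamma>) and 1/a the factor 1/x; what
    remains is the norm of a constant.\<close>
  have "Lp_norm p a b (\<lambda>x. u x /\<^sub>R (x powr (\<gamma> + 1))) \<le> (D / a * M) * (b - a) powr (1 / p)"
  proof (rule Lp_norm_le_of_bounded)
    show "0 \<le> D / a * M" using C0 K N assms(1) by (simp add: M_def)
    fix x assume x: "x \<in> {a<..<b}"
    have "inverse (x powr (\<gamma> + 1)) = x powr (- \<gamma>) / x"
      using x assms(1) by (simp add: powr_add powr_minus divide_inverse)
    also have "\<dots> \<le> D / a" using D[OF x] x assms(1) C0 by (intro frac_le) auto
    finally have "inverse (x powr (\<gamma> + 1)) * norm (u x) \<le> D / a * M"
      using u_le[OF x] x assms(1) C0 by (intro mult_mono) auto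
    then show "norm (u x /\<^sub>R (x powr (\<gamma> + 1))) \<le> D / a * M" by simp
  qed (use assms in auto)
  also have "\<dots> = (C * D / a) * ((b - a) powr (\<alpha> - 1 / p) * (b - a) powr (1 / p)) / K * N"
    by (simp add: M_def)
  also have "C * D / a = a powr (- \<bar>\<gamma>\<bar> - 1) * b powr \<bar>\<gamma>\<bar>"
    using assms(1) unfolding CD by (simp add: powr_diff)
  also have "(b - a) powr (\<alpha> - 1 / p) * (b - a) powr (1 / p) = (b - a) powr \<alpha>"
    by (simp flip: powr_add)
  finally show ?thesis unfolding K_def N_def .
qed

end
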